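(* Consider a left-invariant Lorentzian problem on $G=\mathrm{Aff}_+(\mathbb R)$ given by a matrix $A=\begin{pmatrix}a&b\\c&d\end{pmatrix}$, $|A|>0$, $a\ge0$, with sectional curvature $K<0$. Let $q_1=(x_1,y_1)\in G$ and $d(q_1)=d(\mathrm{Id},q_1)$. (1) If $q_1\notin J^+$, then $d(q_1)=0$. (2) If $q_1\in\partial J^+$, then $d(q_1)=0$. (3) If $q_1\in\operatorname{int}D$, then $d(q_1)=\frac{\tau-\rho}{\Delta}$, where $$\tau=\arcsin\frac{y_1^2+w^2-1}{2y_1w},\qquad \rho=\arcsin\frac{y_1^2-w^2-1}{2w},\qquad w=\frac{x_1-\nu(y_1-1)}{\lambda}.$$ In particular, $d(\operatorname{int}D)=\left(0,\frac{\pi}{\Delta}\right)$. (4) If $q_1\in F$, then $d(q_1)=\frac{\pi}{\Delta}$. (5) If $q_1\in E$, then $d(q_1)=+\infty$.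
   Context: $G=\mathrm{Aff}_+(\mathbb R)=\{(x,y)\in\mathbb R^2: y>0\}$ with product $(x_2,y_2)\cdot(x_1,y_1)=(x_2+y_2x_1,\,y_2y_1)$ and identity $\mathrm{Id}=(0,1)$; left-invariant frame $X_1=y\,\partial_x$, $X_2=y\,\partial_y$. A real matrix $A=\begin{pmatrix}a&b\\c&d\end{pmatrix}$ with $|A|=ad-bc>0$ determines the left-invariant Lorentzian form $g(u_1X_1+u_2X_2)=-v_1^2+v_2^2$, $v_1=au_1+bu_2$, $v_2=cu_1+du_2$, with time orientation in which future directed nonspacelike vectors are those with $v_1\ge|v_2|$. Standing assumption of the paper: $a\ge0$. Write $A^{-1}=\begin{pmatrix}\alpha&\beta\\ \gamma&\delta\end{pmatrix}$. The sectional curvature is $K=(c^2-a^2)/|A|^2=\gamma^2-\delta^2$. A future directed nonspacelike curve is a Lipschitz curve whose velocity is a.e. future directed nonspacelike; its Lorentzian length is $\int\sqrt{v_1^2-v_2^2}\,dt$. $J^+$ is the set of endpoints of such curves starting at $\mathrm{Id}$. The Lorentzian distance $d(q_0,q_1)$ is the supremum of lengths of such curves from $q_0$ to $q_1$, and $0$ if there are none. Boundaries and interiors are taken in $G$. For $K<0$: $\Delta=\sqrt{\delta^2-\gamma^2}$, $\lambda=\frac{\alpha\delta-\beta\gamma}{\Delta^2}$, $\nu=\frac{\beta\delta-\alpha\gamma}{\Delta^2}$; $\lambda_1(x,y)=(c-a)x+(d-b)(y-1)$, $\lambda_2(x,y)=(c+a)x+(d+b)(y-1)$ (here $d$ is the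 matrix entry), $B=\left(\frac{d+b}{c+a},0\right)$, $\lambda_3(q)=\lambda_1(q)-\lambda_1(B)$, and $D=\{q\in G:\lambda_1(q)\le0\le\lambda_2(q),\ \lambda_3(q)>0\}$, $F=\{q\in G:\lambda_3(q)=0\}$, $E=\{q\in G:\lambda_3(q)<0\}$; one has $J^+=D\sqcup F\sqcup E$. *)

theory Defs
  imports "HOL-Analysis.Analysis"
begin

section \<open>The group and its left-invariant fields\<close>

definition Aff :: "(real \<times> real) set" where
  "Aff = {q. snd q > 0}"

definition aff_mult :: "real \<times> real \<Rightarrow> real \<times> real \<Rightarrow> real \<times> real" where
  "aff_mult p q = (fst p + snd p * fst q, snd p * snd q)"

definition aff_id :: "real \<times> real" where
  "aff_id = (0, 1)"

definition X1 :: "real \<times> real \<Rightarrow> real \<times> real" where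
  "X1 q = (snd q, 0)"

definition X2 :: "real \<times> real \<Rightarrow> real \<times> real" where
  "X2 q = (0, snd q)"

definition left_field :: "real^2 \<Rightarrow> real \<times> real \<Rightarrow> real \<times> real" where
  "left_field u q = (u$1) *\<^sub>R X1 q + (u$2) *\<^sub>R X2 q"

text \<open>Coordinates of a tangent vector \<open>h\<close> at \<open>q\<close> in the frame, i.e. the inverse of
  \<open>\<lambda>u. left_field u q\<close> for \<open>q\<close> in the group.\<close>

definition frame_coords :: "real \<times> real \<Rightarrow> real \<times> real \<Rightarrow> real^2" where
  "frame_coords q h = vector [fst h / snd q, snd h / snd q]"

lemma left_field_frame_coords: "q \<in> Aff \<Longrightarrow> left_field (frame_coords q h) q = h"
  by (cases h) (auto simp: Aff_def left_field_def frame_coords_def X1_def X2_def)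

lemma frame_coords_left_field: "q \<in> Aff \<Longrightarrow> frame_coords q (left_field u q) = u"
  by (simp add: Aff_def left_field_def frame_coords_def X1_def X2_def vec_eq_iff forall_2)

lemma left_field_invariant:
  "\<exists>L. (aff_mult p has_derivative L) (at q) \<and> L (left_field u q) = left_field u (aff_mult p q)"
proof (intro exI conjI)
  show "(aff_mult p has_derivative (\<lambda>h. (snd p * fst h, snd p * snd h))) (at q)"
    unfolding aff_mult_def by (auto intro!: derivative_eq_intros)
  show "(snd p * fst (left_field u q), snd p * snd (left_field u q)) = left_field u (aff_mult p q)"
    by (simp add: left_field_def aff_mult_def X1_def X2_def)
qed

section \<open>The Lorentzian form and its curvature\<close>

text \<open>The matrix entries \<open>a, b, c, d\<close> are \<open>A$1$1, A$1$2, A$2$1, A$2$2\<close>.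
  The form is the polarisation of \<open>- v\<^sub>1\<^sup>2 + v\<^sub>2\<^sup>2\<close>, where \<open>v = A u\<close>; vectors of type \<open>real^2\<close> are
  frame coordinates \<open>u\<close>.\<close>

definition lor_form :: "real^2^2 \<Rightarrow> real^2 \<Rightarrow> real^2 \<Rightarrow> real" where
  "lor_form A u w = - ((A *v u)$1 * (A *v w)$1) + (A *v u)$2 * (A *v w)$2"

text \<open>The Lie bracket of left-invariant fields, determined by \<open>[X\<^sub>1, X\<^sub>2] = - X\<^sub>1\<close>.\<close>

definition lie_bracket :: "real^2 \<Rightarrow> real^2 \<Rightarrow> real^2" where
  "lie_bracket u w = vector [- (u$1 * w$2 - u$2 * w$1), 0]"

lemma lie_bracket_vector_fields:
  "\<exists>DU DW. (left_field u has_derivative DU) (at q) \<and> (left_field w has_derivative DW) (at q) \<and>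
     left_field (lie_bracket u w) q = DW (left_field u q) - DU (left_field w q)"
proof -
  have D: "(left_field z has_derivative (\<lambda>h. (z$1 * snd h, z$2 * snd h))) (at q)" for z
  proof -
    have "left_field z = (\<lambda>h. (z$1 * snd h, z$2 * snd h))"
      by (auto simp: left_field_def X1_def X2_def)
    then show ?thesis by (auto intro!: derivative_eq_intros)
  qed
  show ?thesis
    by (intro exI conjI, rule D, rule D)
       (simp add: left_field_def lie_bracket_def X1_def X2_def algebra_simps)
qed

text \<open>The Levi-Civita connection on left-invariant fields, by the Koszul formula (the derivative
  terms vanish because the form is constant on left-invariant fields).\<close>

definition levi_civita :: "real^2^2 \<Rightarrow> real^2 \<Rightarrow> real^2 \<Rightarrow> real^2" where
  "levi_civita A u w = (THE z. \<forall>h. 2 * lor_form A z h =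
     lor_form A (lie_bracket u w) h - lor_form A (lie_bracket w h) u
       + lor_form A (lie_bracket h u) w)"

definition riemann :: "real^2^2 \<Rightarrow> real^2 \<Rightarrow> real^2 \<Rightarrow> real^2 \<Rightarrow> real^2" where
  "riemann A u w h = levi_civita A u (levi_civita A w h) - levi_civita A w (levi_civita A u h)
     - levi_civita A (lie_bracket u w) h"

definition sectional_curvature :: "real^2^2 \<Rightarrow> real" where
  "sectional_curvature A = (let e1 = axis 1 1; e2 = axis 2 1 in
     lor_form A (riemann A e1 e2 e2) e1 /
     (lor_form A e1 e1 * lor_form A e2 e2 - (lor_form A e1 e2)\<^sup>2))"

lemma levi_civita_eq:
  fixes A :: "real^2^2" and u w :: "real^2"
  assumes "det A > 0"
  defines "p \<equiv> (A$2$1)\<^sup>2 - (A$1$1)\<^sup>2" and "m \<equiv> A$2$1 * A$2$2 - A$1$1 * A$1$2"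
    and "r \<equiv> (A$2$2)\<^sup>2 - (A$1$2)\<^sup>2"
  defines "k1 \<equiv> - (w$2) * (u$1 * p + u$2 * m)"
    and "k2 \<equiv> w$1 * (u$1 * p + u$2 * m)"
  shows "levi_civita A u w = vector [- (r * k1 - m * k2) / (det A)\<^sup>2, - (p * k2 - m * k1) / (det A)\<^sup>2]"
proof -
  define z :: "real^2" where
    "z = vector [- (r * k1 - m * k2) / (det A)\<^sup>2, - (p * k2 - m * k1) / (det A)\<^sup>2]"
  have d: "p * r - m\<^sup>2 = - (det A)\<^sup>2"
    by (simp add: p_def m_def r_def det_2 power2_eq_square algebra_simps)
  have d0: "det A \<noteq> 0" using assms(1) by simp
  have form: "lor_form A x h = (x$1 * p + x$2 * m) * h$1 + (x$1 * m + x$2 * r) * h$2" for x h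
    by (simp add: lor_form_def matrix_vector_mult_def sum_2 p_def m_def r_def
        power2_eq_square algebra_simps)
  have kos: "lor_form A (lie_bracket u w) h - lor_form A (lie_bracket w h) u
       + lor_form A (lie_bracket h u) w = 2 * (k1 * h$1 + k2 * h$2)" for h
    by (simp add: form lie_bracket_def k1_def k2_def power2_eq_square algebra_simps)
  have z1: "z$1 * p + z$2 * m = k1"
  proof -
    have "z$1 * p + z$2 * m = - ((p * r - m\<^sup>2) * k1) / (det A)\<^sup>2"
      by (simp add: z_def power2_eq_square add_divide_distrib[symmetric] algebra_simps diff_divide_distrib[symmetric])
    then show ?thesis using d0 by (simp add: d)
  qed
  have z2: "z$1 * m + z$2 * r = k2"
  proof -
    have "z$1 * m + z$2 * r = - ((p * r - m\<^sup>2) * k2) / (det A)\<^sup>2"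
      by (simp add: z_def power2_eq_square add_divide_distrib[symmetric] algebra_simps diff_divide_distrib[symmetric])
    then show ?thesis using d0 by (simp add: d)
  qed
  have "levi_civita A u w = z"
    unfolding levi_civita_def kos
  proof (rule the_equality)
    show "\<forall>h. 2 * lor_form A z h = 2 * (k1 * h$1 + k2 * h$2)"
      by (simp add: form z1 z2)
  next
    fix x assume x: "\<forall>h. 2 * lor_form A x h = 2 * (k1 * h$1 + k2 * h$2)"
    have a1: "x$1 * p + x$2 * m = k1"
      using spec[OF x, of "axis 1 1"] by (simp add: form axis_def)
    have a2: "x$1 * m + x$2 * r = k2"
      using spec[OF x, of "axis 2 1"] by (simp add: form axis_def)
    have "(x$1 - z$1) * (p * r - m\<^sup>2) = r * ((x$1 * p + x$2 * m) - (z$1 * p + z$2 * m))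
        - m * ((x$1 * m + x$2 * r) - (z$1 * m + z$2 * r))"
      by (simp add: power2_eq_square algebra_simps)
    then have "(x$1 - z$1) * (p * r - m\<^sup>2) = 0"
      by (simp only: a1 a2 z1 z2) simp
    moreover have "(x$2 - z$2) * (p * r - m\<^sup>2) = p * ((x$1 * m + x$2 * r) - (z$1 * m + z$2 * r))
        - m * ((x$1 * p + x$2 * m) - (z$1 * p + z$2 * m))"
      by (simp add: power2_eq_square algebra_simps)
    then have "(x$2 - z$2) * (p * r - m\<^sup>2) = 0"
      by (simp only: a1 a2 z1 z2) simp
    ultimately show "x = z"
      using d0 by (simp add: d vec_eq_iff forall_2)
  qed
  then show ?thesis by (simp add: z_def)
qed

lemma sectional_curvature_eq:
  fixes A :: "real^2^2"
  assumes "det A > 0"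
  shows "sectional_curvature A = ((A$2$1)\<^sup>2 - (A$1$1)\<^sup>2) / (det A)\<^sup>2"
proof -
  define p m r where defs: "p = (A$2$1)\<^sup>2 - (A$1$1)\<^sup>2" "m = A$2$1 * A$2$2 - A$1$1 * A$1$2"
    "r = (A$2$2)\<^sup>2 - (A$1$2)\<^sup>2"
  define s where "s = (det A)\<^sup>2"
  have s0: "s \<noteq> 0" using assms by (simp add: s_def)
  have d: "p * r - m\<^sup>2 = - s"
    by (simp add: defs s_def det_2 power2_eq_square algebra_simps)
  have form: "lor_form A x h = (x$1 * p + x$2 * m) * h$1 + (x$1 * m + x$2 * r) * h$2" for x h
    by (simp add: lor_form_def matrix_vector_mult_def sum_2 defs power2_eq_square algebra_simps)
  note lc = levi_civita_eq[OF assms, folded defs, folded s_def]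
  have lcf: "lor_form A (levi_civita A u w) h =
      (u$1 * p + u$2 * m) * (w$1 * h$2 - w$2 * h$1)" for u w h
  proof -
    have "s * lor_form A (levi_civita A u w) h =
        - (p * r - m\<^sup>2) * ((u$1 * p + u$2 * m) * (w$1 * h$2 - w$2 * h$1))"
      using s0 by (simp add: form lc field_simps power2_eq_square)
    then show ?thesis using s0 by (simp add: d)
  qed
  have diff: "lor_form A (x - y) h = lor_form A x h - lor_form A y h" for x y h
    by (simp add: form algebra_simps)
  have e12: "lie_bracket (axis 1 1) (axis 2 1) = - axis 1 1"
    by (simp add: lie_bracket_def vec_eq_iff forall_2 axis_def)
  have n: "s * (levi_civita A (axis 2 1) (axis 2 1) $ 2) = - (m * m)"
    "s * (levi_civita A (axis 1 1) (axis 2 1) $ 2) = - (m * p)"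
    using s0 by (simp_all add: lc axis_def)
  have "lor_form A (riemann A (axis 1 1) (axis 2 1) (axis 2 1)) (axis 1 1)
      = - p * (levi_civita A (axis 2 1) (axis 2 1) $ 2)
        + m * (levi_civita A (axis 1 1) (axis 2 1) $ 2) - p"
    by (simp add: riemann_def diff lcf e12) (simp add: axis_def)
  also have "\<dots> = - p"
  proof -
    have "s * (- p * (levi_civita A (axis 2 1) (axis 2 1) $ 2)
        + m * (levi_civita A (axis 1 1) (axis 2 1) $ 2)) = 0"
      using n by algebra
    then show ?thesis using s0 by simp
  qed
  finally have "sectional_curvature A = - p / (p * r - m\<^sup>2)"
    by (simp add: sectional_curvature_def Let_def form axis_def)
  then show ?thesis using s0 by (simp add: d) (simp add: defs s_def)
qed

section \<open>Causal curves, length and distance\<close>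

definition future_causal :: "real^2^2 \<Rightarrow> real^2 \<Rightarrow> bool" where
  "future_causal A u \<longleftrightarrow> (A *v u)$1 \<ge> \<bar>(A *v u)$2\<bar>"

definition future_causal_curve :: "real^2^2 \<Rightarrow> (real \<Rightarrow> real \<times> real) \<Rightarrow> real \<Rightarrow> bool" where
  "future_causal_curve A \<gamma> T \<longleftrightarrow> T > 0 \<and> \<gamma> ` {0..T} \<subseteq> Aff \<and> (\<exists>C. C-lipschitz_on {0..T} \<gamma>) \<and>
     (AE t in lebesgue_on {0..T}. \<gamma> differentiable (at t) \<and>
        future_causal A (frame_coords (\<gamma> t) (vector_derivative \<gamma> (at t))))"

text \<open>The integrand is bounded and measurable for a future causal curve (Lipschitz, with compact
  image in the group), so the default value 0 of the integral never intervenes.\<close>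

definition lor_length :: "real^2^2 \<Rightarrow> (real \<Rightarrow> real \<times> real) \<Rightarrow> real \<Rightarrow> real" where
  "lor_length A \<gamma> T = (LINT t|lebesgue_on {0..T}.
     (let v = A *v frame_coords (\<gamma> t) (vector_derivative \<gamma> (at t)) in sqrt ((v$1)\<^sup>2 - (v$2)\<^sup>2)))"

definition causal_lengths :: "real^2^2 \<Rightarrow> real \<times> real \<Rightarrow> real \<times> real \<Rightarrow> real set" where
  "causal_lengths A q0 q1 =
     {lor_length A \<gamma> T | \<gamma> T. future_causal_curve A \<gamma> T \<and> \<gamma> 0 = q0 \<and> \<gamma> T = q1}"

definition lor_dist :: "real^2^2 \<Rightarrow> real \<times> real \<Rightarrow> real \<times> real \<Rightarrow> ereal" where
  "lor_dist A q0 q1 =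
     (if causal_lengths A q0 q1 = {} then 0 else Sup (ereal ` causal_lengths A q0 q1))"

definition J_plus :: "real^2^2 \<Rightarrow> (real \<times> real) set" where
  "J_plus A = {q1. \<exists>\<gamma> T. future_causal_curve A \<gamma> T \<and> \<gamma> 0 = aff_id \<and> \<gamma> T = q1}"

section \<open>Quantities and regions for negative curvature\<close>

text \<open>With \<open>M = matrix_inv A\<close>, the entries \<open>\<alpha>, \<beta>, \<gamma>, \<delta>\<close> of the inverse are
  \<open>M$1$1, M$1$2, M$2$1, M$2$2\<close>.\<close>

definition Delta :: "real^2^2 \<Rightarrow> real" where
  "Delta A = (let M = matrix_inv A in sqrt ((M$2$2)\<^sup>2 - (M$2$1)\<^sup>2))"

definition lam :: "real^2^2 \<Rightarrow> real" where
  "lam A = (let M = matrix_inv A in (M$1$1 * M$2$2 - M$1$2 * M$2$1) / (Delta A)\<^sup>2)"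

definition nu :: "real^2^2 \<Rightarrow> real" where
  "nu A = (let M = matrix_inv A in (M$1$2 * M$2$2 - M$1$1 * M$2$1) / (Delta A)\<^sup>2)"

definition lambda1 :: "real^2^2 \<Rightarrow> real \<times> real \<Rightarrow> real" where
  "lambda1 A q = (A$2$1 - A$1$1) * fst q + (A$2$2 - A$1$2) * (snd q - 1)"

definition lambda2 :: "real^2^2 \<Rightarrow> real \<times> real \<Rightarrow> real" where
  "lambda2 A q = (A$2$1 + A$1$1) * fst q + (A$2$2 + A$1$2) * (snd q - 1)"

definition point_B :: "real^2^2 \<Rightarrow> real \<times> real" where
  "point_B A = ((A$2$2 + A$1$2) / (A$2$1 + A$1$1), 0)"

definition lambda3 :: "real^2^2 \<Rightarrow> real \<times> real \<Rightarrow> real" where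
  "lambda3 A q = lambda1 A q - lambda1 A (point_B A)"

definition region_D :: "real^2^2 \<Rightarrow> (real \<times> real) set" where
  "region_D A = {q \<in> Aff. lambda1 A q \<le> 0 \<and> 0 \<le> lambda2 A q \<and> lambda3 A q > 0}"

definition region_F :: "real^2^2 \<Rightarrow> (real \<times> real) set" where
  "region_F A = {q \<in> Aff. lambda3 A q = 0}"

definition region_E :: "real^2^2 \<Rightarrow> (real \<times> real) set" where
  "region_E A = {q \<in> Aff. lambda3 A q < 0}"

end

theory Submission
  imports Defs
begin

text \<open>
  In the coordinates \<open>w = (x - \<nu> (y - 1)) / \<lambda>\<close> and \<open>y\<close> the Lorentzian form becomes
  \<open>\<Delta>\<^sup>-\<^sup>2 (- dw\<^sup>2 + dy\<^sup>2) / y\<^sup>2\<close>, so every problem with \<open>K < 0\<close> is, up to the factor \<open>1 / \<Delta>\<close>, the same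
  half-plane model of constant curvature. Everything is done in its null coordinates \<open>p = w + y\<close>
  and \<open>q = w - y\<close>: the identity is \<open>(1, -1)\<close>, the group is \<open>q < p\<close>, a curve is future directed
  nonspacelike iff \<open>p\<close> and \<open>q\<close> are nondecreasing along it, and its length is
  \<open>\<Delta>\<^sup>-\<^sup>1 \<integral> 2 \<surd>(p' q') / (p - q) dt\<close>. The signs of the three linear functions in the statement
  compare \<open>q\<close> with \<open>-1\<close>, \<open>p\<close> with \<open>1\<close> and \<open>q\<close> with \<open>1\<close>. So the attainable set is \<open>p \<ge> 1\<close>, \<open>q \<ge> -1\<close>,
  and it is divided into \<open>D\<close>, \<open>F\<close> and \<open>E\<close> by \<open>q < 1\<close>, \<open>q = 1\<close> and \<open>q > 1\<close>.

  The distance is \<open>\<theta> / \<Delta>\<close> with \<open>cos \<theta> = (1 - p q) / (p - q)\<close> (\<open>null_dist\<close>). For the upper bound,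
  \<open>\<theta>\<close> is a calibration: it satisfies the eikonal equation \<open>\<theta>\<^sub>p \<theta>\<^sub>q = 1 / (p - q)\<^sup>2\<close> (\<open>radial_slope\<close>), hence
  along a causal curve \<open>d\<theta>/dt = \<theta>\<^sub>p p' + \<theta>\<^sub>q q' \<ge> 2 \<surd>(p' q') / (p - q)\<close> by the inequality between the
  arithmetic and the geometric mean. As \<open>\<theta>\<close> is singular where \<open>p = 1\<close> or \<open>q = \<plusminus>1\<close>, in particular at the
  starting point, the estimate is made for the curve \<open>(p / r, r q)\<close> with \<open>r < 1\<close>, which stays away from
  these lines, and then \<open>r\<close> tends to \<open>1\<close> (\<open>null_dist_length_bound\<close>). This covers the interior of \<open>D\<close>,
  \<open>F\<close> and the boundary of the attainable set at once.

  For the lower bound, curves are assembled from explicit pieces. Inside \<open>D\<close> the geodesic, which in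
  null coordinates is the graph of an involutive Moebius transformation, has length exactly
  \<open>\<theta> / \<Delta>\<close> (\<open>realizes_geodesic\<close>). A point of \<open>F\<close> is reached by a geodesic to a point slightly below it
  followed by a null segment, which gives lengths tending to \<open>\<pi> / \<Delta>\<close>. On the way to a point of \<open>E\<close> a
  curve can follow the line \<open>p - q = e\<close> over a range of \<open>p\<close> independent of \<open>e\<close>; this contributes a length
  proportional to \<open>1 / e\<close>, whence the infinite distance (\<open>lor_dist_E\<close>).
\<close>

section \<open>Lipschitz functions and their derivatives\<close>

text \<open>The forward difference quotients of step \<open>h\<close> are bounded by the Lipschitz constant and converge to the
  derivative almost everywhere, so by dominated convergence their integrals converge to the integral
  of the derivative. On the other hand, with an antiderivative \<open>\<Phi>\<close> of \<open>g\<close> these integrals are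
  differences of difference quotients of \<open>\<Phi>\<close> at the two end points, and converge to \<open>g b - g a\<close>.\<close>

lemma lipschitz_has_integral_derivative:
  fixes g g' :: "real \<Rightarrow> real"
  assumes lip: "L-lipschitz_on {a..b} g" and "a \<le> b"
    and ae: "AE t in lebesgue_on {a..b}. (g has_real_derivative g' t) (at t)"
  shows "(g' has_integral (g b - g a)) {a..b}"
proof -
  have "AE t in lebesgue. t \<in> {a..b} \<longrightarrow> (g has_real_derivative g' t) (at t)"
    using ae by (simp add: AE_restrict_space_iff)
  then obtain N where N: "negligible N"
    and der: "\<And>t. t \<in> {a..b} \<Longrightarrow> t \<notin> N \<Longrightarrow> (g has_real_derivative g' t) (at t)"
    unfolding completion.AE_iff_null_sets negligible_iff_null_sets by fastforce
  \<comment> \<open>At \<open>b\<close> the forward quotients only see the constant continuation of \<open>g\<close>.\<close>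
  define N' where "N' = insert b N"
  have N': "negligible N'" using N by (simp add: N'_def)
  define G where "G x = g (min x b)" for x
  have L: "L \<ge> 0" using lip lipschitz_on_nonneg by blast
  have clip: "\<bar>min x b - min y b\<bar> \<le> \<bar>x - y\<bar>" for x y by linarith
  have G_lip: "\<bar>G x - G y\<bar> \<le> L * \<bar>x - y\<bar>" if "a \<le> x" "a \<le> y" for x y
  proof -
    have "\<bar>G x - G y\<bar> \<le> L * \<bar>min x b - min y b\<bar>"
      using lipschitz_onD[OF lip, of "min x b" "min y b"] that \<open>a \<le> b\<close>
      by (auto simp: G_def dist_real_def)
    also have "\<dots> \<le> L * \<bar>x - y\<bar>" using L clip by (intro mult_left_mono) auto
    finally show ?thesis .
  qed
  have "L-lipschitz_on {a..b + 1} G"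
    using G_lip L by (auto intro!: lipschitz_onI simp: dist_real_def)
  then have contG: "continuous_on {a..b + 1} G"
    by (rule lipschitz_on_continuous_on)
  then obtain \<Phi> where \<Phi>: "\<And>x. x \<in> {a..b + 1} \<Longrightarrow>
      (\<Phi> has_vector_derivative G x) (at x within {a..b + 1})"
    using antiderivative_continuous by blast
  define h where "h k = inverse (real (Suc k))" for k
  have h: "0 < h k" "h k \<le> 1" for k by (auto simp: h_def field_simps)
  define s where "s k x = (G (x + h k) - G x) / h k" for k x
  have s_int: "(s k has_integral
      (\<Phi> (b + h k) - \<Phi> b) / h k - (\<Phi> (a + h k) - \<Phi> a) / h k) {a..b}" for k
  proof -
    have "((\<lambda>x. (\<Phi> (x + h k) - \<Phi> x) / h k) has_vector_derivative s k x) (at x within {a..b})"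
      if x: "x \<in> {a..b}" for x
    proof -
      have 1: "(\<Phi> has_vector_derivative G x) (at x within {a..b})"
        using \<Phi>[of x] x by (auto intro: has_vector_derivative_within_subset)
      have "(\<Phi> has_vector_derivative G (x + h k)) (at (x + h k) within (\<lambda>x. x + h k) ` {a..b})"
        using \<Phi>[of "x + h k"] x h[of k] by (auto intro: has_vector_derivative_within_subset)
      then have "(\<Phi> \<circ> (\<lambda>x. x + h k) has_vector_derivative 1 *\<^sub>R G (x + h k)) (at x within {a..b})"
        by (intro vector_diff_chain_within) (auto intro!: derivative_eq_intros)
      then have 2: "((\<lambda>x. \<Phi> (x + h k)) has_vector_derivative G (x + h k)) (at x within {a..b})"
        by (simp add: o_def)
      show ?thesis
        unfolding s_def using has_vector_derivative_divide[OF has_vector_derivative_diff[OF 2 1]] .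
    qed
    from fundamental_theorem_of_calculus[OF \<open>a \<le> b\<close> this] show ?thesis
      by (simp add: diff_divide_distrib)
  qed
  have quot: "(\<lambda>k. (\<Phi> (x + h k) - \<Phi> x) / h k) \<longlonglongrightarrow> G x" if x: "x \<in> {a..b}" for x
  proof -
    have "(\<Phi> has_real_derivative G x) (at x within {a..b + 1})"
      using \<Phi>[of x] x by (simp add: has_real_derivative_iff_has_vector_derivative)
    then have "((\<lambda>y. (\<Phi> y - \<Phi> x) / (y - x)) \<longlongrightarrow> G x) (at x within {a..b + 1})"
      by (simp add: has_field_derivative_iff)
    moreover have "filterlim (\<lambda>k. x + h k) (at x within {a..b + 1}) sequentially"
    proof -
      have "(\<lambda>k. x + h k) \<longlonglongrightarrow> x + 0"
        unfolding h_def by (intro tendsto_intros LIMSEQ_inverse_real_of_nat)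
      moreover have "x + h k \<in> {a..b + 1} \<and> x + h k \<noteq> x" for k
        using x h[of k] by auto
      ultimately show ?thesis by (simp add: filterlim_at)
    qed
    ultimately show ?thesis by (auto dest: filterlim_compose)
  qed
  have s_lim: "(\<lambda>k. s k x) \<longlonglongrightarrow> g' x" if x: "x \<in> {a..b}" "x \<notin> N'" for x
  proof -
    have "x < b" using x by (auto simp: N'_def)
    have "((\<lambda>y. (g y - g x) / (y - x)) \<longlongrightarrow> g' x) (at x)"
      using der[of x] x by (simp add: has_field_derivative_iff N'_def)
    have lim: "(\<lambda>k. x + h k) \<longlonglongrightarrow> x + 0"
      unfolding h_def by (intro tendsto_intros LIMSEQ_inverse_real_of_nat)
    moreover have "x + h k \<noteq> x" for k using h[of k] by simp
    ultimately have "filterlim (\<lambda>k. x + h k) (at x) sequentially"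
      by (simp add: filterlim_at)
    with \<open>((\<lambda>y. (g y - g x) / (y - x)) \<longlongrightarrow> g' x) (at x)\<close>
    have "(\<lambda>k. (g (x + h k) - g x) / (x + h k - x)) \<longlonglongrightarrow> g' x"
      by (rule filterlim_compose)
    moreover have "\<forall>\<^sub>F k in sequentially. x + h k < b"
      using order_tendstoD(2)[OF lim] \<open>x < b\<close> by simp
    then have "\<forall>\<^sub>F k in sequentially. (g (x + h k) - g x) / (x + h k - x) = s k x"
      by eventually_elim (use \<open>x < b\<close> in \<open>simp add: s_def G_def\<close>)
    ultimately show ?thesis by (rule Lim_transform_eventually)
  qed
  have s_bound: "\<bar>s k x\<bar> \<le> L" if "x \<in> {a..b}" for k x
    using G_lip[of "x + h k" x] that h[of k] by (simp add: s_def field_simps)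
  define s' where "s' k x = (if x \<in> N' then 0 else s k x)" for k x
  define g'' where "g'' x = (if x \<in> N' then 0 else g' x)" for x
  have s'_int: "(s' k has_integral
      (\<Phi> (b + h k) - \<Phi> b) / h k - (\<Phi> (a + h k) - \<Phi> a) / h k) {a..b}" for k
    by (rule has_integral_spike[OF N' _ s_int]) (auto simp: s'_def)
  have "s' k integrable_on {a..b}" for k using s'_int by blast
  moreover have "norm (s' k x) \<le> L" if "x \<in> {a..b}" for k x
    using s_bound[OF that] L by (auto simp: s'_def)
  moreover have "(\<lambda>k. s' k x) \<longlonglongrightarrow> g'' x" if "x \<in> {a..b}" for x
    using s_lim[OF that] by (auto simp: s'_def g''_def)
  ultimately have "g'' integrable_on {a..b}"
    "(\<lambda>k. integral {a..b} (s' k)) \<longlonglongrightarrow> integral {a..b} g''"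
    using dominated_convergence[of s' "{a..b}" "\<lambda>_. L" g''] by auto
  moreover have "(\<lambda>k. integral {a..b} (s' k)) \<longlonglongrightarrow> G b - G a"
    using tendsto_diff[OF quot quot, of b a] \<open>a \<le> b\<close> integral_unique[OF s'_int] by simp
  ultimately have "(g'' has_integral G b - G a) {a..b}"
    by (metis LIMSEQ_unique integrable_integral)
  then have "(g' has_integral G b - G a) {a..b}"
    by (rule has_integral_spike[OF N', rotated]) (auto simp: g''_def)
  then show ?thesis using \<open>a \<le> b\<close> by (simp add: G_def)
qed

text \<open>Integrate \<open>f \<le> g'\<close>. If \<open>f\<close> is not integrable, its integral has the default value \<open>0\<close>, and the
  right-hand side is nonnegative because \<open>g\<close> has a nonnegative derivative almost everywhere.\<close>

lemma lebesgue_integral_le_increment: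
  fixes f g :: "real \<Rightarrow> real"
  assumes lip: "L-lipschitz_on {a..b} g" and "a \<le> b"
    and ae: "AE t in lebesgue_on {a..b}. \<exists>D. (g has_real_derivative D) (at t) \<and> 0 \<le> f t \<and> f t \<le> D"
  shows "integral\<^sup>L (lebesgue_on {a..b}) f \<le> g b - g a"
proof -
  have le: "integral\<^sup>L (lebesgue_on {a..b}) k \<le> g b - g a"
    if k: "AE t in lebesgue_on {a..b}. k t \<le> deriv g t" "integrable (lebesgue_on {a..b}) k"
    for k :: "real \<Rightarrow> real"
  proof -
    \<comment> \<open>Taking the maximum changes the derivative on a null set only and makes the comparison
      with \<open>k\<close> hold everywhere.\<close>
    have "((\<lambda>t. max (k t) (deriv g t)) has_integral (g b - g a)) {a..b}"
    proof (rule lipschitz_has_integral_derivative[OF lip \<open>a \<le> b\<close>])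
      show "AE t in lebesgue_on {a..b}. (g has_real_derivative max (k t) (deriv g t)) (at t)"
        using ae k(1) by eventually_elim (auto simp: max_def DERIV_imp_deriv)
    qed
    moreover have "(k has_integral integral\<^sup>L (lebesgue_on {a..b}) k) {a..b}"
      using k(2) by (intro has_integral_integral_lebesgue_on) auto
    moreover have "k t \<le> max (k t) (deriv g t)" for t by simp
    ultimately show ?thesis using has_integral_le by blast
  qed
  have der: "AE t in lebesgue_on {a..b}. 0 \<le> f t \<and> f t \<le> deriv g t"
    using ae by eventually_elim (auto simp: DERIV_imp_deriv)
  show ?thesis
  proof (cases "integrable (lebesgue_on {a..b}) f")
    case True
    then show ?thesis using der by (intro le) (auto elim!: eventually_mono)
  next
    case False
    have "AE t in lebesgue_on {a..b}. 0 \<le> deriv g t"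
      using der by eventually_elim linarith
    then have "0 \<le> g b - g a"
      using le[of "\<lambda>_. 0"] by simp
    then show ?thesis using False by (simp add: not_integrable_integral_eq)
  qed
qed

lemma lipschitz_on_bounded_derivative:
  fixes f :: "real \<Rightarrow> real"
  assumes "convex S" "0 \<le> C"
    and "\<And>x. x \<in> S \<Longrightarrow> (f has_real_derivative f' x) (at x)" "\<And>x. x \<in> S \<Longrightarrow> \<bar>f' x\<bar> \<le> C"
  shows "C-lipschitz_on S f"
proof (rule lipschitz_onI)
  show "dist (f x) (f y) \<le> C * dist x y" if "x \<in> S" "y \<in> S" for x y
    using field_differentiable_bound[OF assms(1), of f f' C x y] assms(3,4) that
    by (auto simp: dist_norm intro: DERIV_subset)
qed (fact assms(2))

lemma AE_lebesgue_on_subinterval: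
  fixes a b c d :: real
  assumes ae: "AE t in lebesgue_on {a..b}. P t" and sub: "{c..d} \<subseteq> {a..b}"
  shows "AE t in lebesgue_on {c..d}. P t"
proof -
  have "AE t in lebesgue. t \<in> {a..b} \<longrightarrow> P t"
    using ae by (simp add: AE_restrict_space_iff)
  then have "AE t in lebesgue. t \<in> {c..d} \<longrightarrow> P t"
    by (rule eventually_mono) (use sub in blast)
  then show ?thesis by (simp add: AE_restrict_space_iff)
qed

lemma lipschitz_nondecreasing:
  fixes g :: "real \<Rightarrow> real"
  assumes "L-lipschitz_on {a..b} g" "a \<le> b"
    and "AE t in lebesgue_on {a..b}. \<exists>D. (g has_real_derivative D) (at t) \<and> 0 \<le> D"
  shows "g a \<le> g b"
  using lebesgue_integral_le_increment[OF assms(1,2), of "\<lambda>_. 0"] assms(3) by simp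

section \<open>The distance function of the model in null coordinates\<close>

text \<open>The distance from \<open>(1, -1)\<close> to \<open>(p, q)\<close> for the form \<open>- 4 dp dq / (p - q)\<^sup>2\<close>, in the region
  \<open>1 \<le> p\<close>, \<open>-1 \<le> q \<le> 1\<close>, \<open>q < p\<close>.\<close>

definition null_dist :: "real \<Rightarrow> real \<Rightarrow> real" where
  "null_dist p q = arccos ((1 - p * q) / (p - q))"

lemma null_dist_arg_bounds:
  fixes p q :: real
  assumes "1 \<le> p" "-1 \<le> q" "q \<le> 1" "q < p"
  shows "-1 \<le> (1 - p * q) / (p - q)" "(1 - p * q) / (p - q) \<le> 1"
proof -
  have "0 \<le> (p - 1) * (q + 1)" "0 \<le> (p + 1) * (1 - q)"
    using assms by auto
  then show "-1 \<le> (1 - p * q) / (p - q)" "(1 - p * q) / (p - q) \<le> 1"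
    using assms by (auto simp: field_simps)
qed

lemma strict_null_dist_bounds:
  fixes p q :: real
  assumes "1 < p" "-1 < q" "q < 1"
  shows "0 < null_dist p q" "null_dist p q < pi"
proof -
  have "0 < (p - 1) * (q + 1)" "0 < (p + 1) * (1 - q)"
    using assms by auto
  then have "-1 < (1 - p * q) / (p - q)" "(1 - p * q) / (p - q) < 1"
    using assms by (auto simp: field_simps)
  then show "0 < null_dist p q" "null_dist p q < pi"
    unfolding null_dist_def using arccos_lt_bounded by auto
qed

text \<open>An expression for \<open>null_dist\<close> in which the two variables separate under a function with derivative at
  most \<open>1\<close>. This makes both the derivative and the Lipschitz estimate a matter of one variable.\<close>

definition radial :: "real \<Rightarrow> real \<Rightarrow> real" where
  "radial p q = 2 * arctan (exp (ln ((p - 1) / (p + 1)) / 2 + ln ((1 + q) / (1 - q)) / 2))"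

lemma exp_half_ln_square:
  fixes p q :: real
  assumes "1 < p" "-1 < q" "q < 1"
  shows "(exp (ln ((p - 1) / (p + 1)) / 2 + ln ((1 + q) / (1 - q)) / 2))\<^sup>2
    = (p - 1) * (1 + q) / ((p + 1) * (1 - q))"
proof -
  have "(exp (ln ((p - 1) / (p + 1)) / 2 + ln ((1 + q) / (1 - q)) / 2))\<^sup>2
      = exp (ln ((p - 1) / (p + 1)) + ln ((1 + q) / (1 - q)))"
    by (simp add: exp_double[symmetric] algebra_simps)
  also have "\<dots> = (p - 1) * (1 + q) / ((p + 1) * (1 - q))"
    using assms by (simp add: exp_add)
  finally show ?thesis .
qed

lemma one_plus_ratio:
  fixes p q :: real
  assumes "p + 1 \<noteq> 0" "1 - q \<noteq> 0"
  shows "1 + (p - 1) * (1 + q) / ((p + 1) * (1 - q)) = 2 * (p - q) / ((p + 1) * (1 - q))"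
proof -
  have "(p + 1) * (1 - q) + (p - 1) * (1 + q) = 2 * (p - q)" by (simp add: algebra_simps)
  then show ?thesis using assms by (simp add: add_divide_eq_iff)
qed

text \<open>With \<open>s\<close> the exponential in \<open>radial\<close>, both sides lie in \<open>(0, \<pi>)\<close> and have the cosine
  \<open>(1 - s\<^sup>2) / (1 + s\<^sup>2)\<close>.\<close>

lemma radial_eq_null_dist:
  assumes "1 < p" "-1 < q" "q < 1"
  shows "radial p q = null_dist p q"
proof -
  define s where "s = exp (ln ((p - 1) / (p + 1)) / 2 + ln ((1 + q) / (1 - q)) / 2)"
  have s: "s > 0" "s\<^sup>2 = (p - 1) * (1 + q) / ((p + 1) * (1 - q))"
    using exp_half_ln_square[OF assms] by (auto simp: s_def)
  have "cos (2 * arctan s) = 2 / (1 + s\<^sup>2) - 1"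
    by (simp add: cos_double_cos cos_arctan power_divide)
  also have "1 + s\<^sup>2 = 2 * (p - q) / ((p + 1) * (1 - q))"
    unfolding s(2) using assms by (intro one_plus_ratio) auto
  also have "2 / (2 * (p - q) / ((p + 1) * (1 - q))) - 1 = (1 - p * q) / (p - q)"
    using assms by (simp add: field_simps)
  finally have "(1 - p * q) / (p - q) = cos (2 * arctan s)" by simp
  moreover have "0 < arctan s" "arctan s < pi / 2"
    using s arctan_ubound by auto
  ultimately show ?thesis
    by (simp add: null_dist_def radial_def s_def[symmetric] arccos_cos)
qed

text \<open>The eikonal equation. The factors on the left are the partial derivatives of \<open>radial\<close>, since
  \<open>2 s / (1 + s\<^sup>2)\<close> is the derivative of \<open>2 arctan s\<close> with respect to \<open>ln s\<close>.\<close>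

lemma radial_slope:
  fixes p q s S :: real
  assumes "1 < p" "-1 < q" "q < 1"
    and S: "S = 2 * s / (1 + s\<^sup>2)"
    and s: "s = exp (ln ((p - 1) / (p + 1)) / 2 + ln ((1 + q) / (1 - q)) / 2)"
  shows "(S / (p\<^sup>2 - 1)) * (S / (1 - q\<^sup>2)) = 1 / (p - q)\<^sup>2"
proof -
  have s2: "s\<^sup>2 = (p - 1) * (1 + q) / ((p + 1) * (1 - q))"
    using exp_half_ln_square[OF assms(1-3)] by (simp add: s)
  have one: "1 + s\<^sup>2 = 2 * (p - q) / ((p + 1) * (1 - q))"
    unfolding s2 using assms(1-3) by (intro one_plus_ratio) auto
  have "S\<^sup>2 = 4 * s\<^sup>2 / (1 + s\<^sup>2)\<^sup>2" by (simp add: S power2_eq_square)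
  also have "\<dots> = (p - 1) * (1 + q) * ((p + 1) * (1 - q)) / (p - q)\<^sup>2"
  proof -
    have *: "4 * (z / y) / (2 * d / y)\<^sup>2 = z * y / d\<^sup>2" if "y \<noteq> 0" "d \<noteq> 0" for d y z :: real
      using that by (simp add: field_simps power2_eq_square)
    show ?thesis unfolding one unfolding s2
      by (rule *) (use assms(1-3) in auto)
  qed
  also have "\<dots> = (p\<^sup>2 - 1) * (1 - q\<^sup>2) / (p - q)\<^sup>2"
    by (simp add: power2_eq_square algebra_simps)
  finally have S2: "S\<^sup>2 = (p\<^sup>2 - 1) * (1 - q\<^sup>2) / (p - q)\<^sup>2" .
  have "p\<^sup>2 - 1 \<noteq> 0" using assms(1) by (simp add: power2_eq_1_iff)
  moreover have "1 - q\<^sup>2 \<noteq> 0" using assms(2,3) power2_eq_1_iff[of q] by auto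
  ultimately show ?thesis
    using S2 by (simp add: power2_eq_square[of S, symmetric])
qed

lemma weighted_sum_ge_geometric_mean:
  fixes a b x y :: real
  assumes "0 \<le> a" "0 \<le> b" "0 \<le> x" "0 \<le> y"
  shows "2 * sqrt (x * y) * sqrt (a * b) \<le> a * x + b * y"
proof -
  have "0 \<le> (sqrt (a * x) - sqrt (b * y))\<^sup>2" by simp
  also have "\<dots> = a * x + b * y - 2 * sqrt (x * y) * sqrt (a * b)"
    using assms by (simp add: power2_diff real_sqrt_mult power_mult_distrib)
  finally show ?thesis by simp
qed

text \<open>The calibration inequality: the chain rule, then \<open>weighted_sum_ge_geometric_mean\<close>, whose constant is
  computed by the eikonal equation \<open>radial_slope\<close>.\<close>

lemma radial_derivative_ge:
  assumes "1 < p t" "-1 < q t" "q t < 1"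
    and p: "(p has_real_derivative p') (at t)" and q: "(q has_real_derivative q') (at t)"
    and "0 \<le> p'" "0 \<le> q'"
  shows "\<exists>D. ((\<lambda>t. radial (p t) (q t)) has_real_derivative D) (at t)
      \<and> 2 * sqrt (p' * q') / (p t - q t) \<le> D"
proof -
  define s where "s = exp (ln ((p t - 1) / (p t + 1)) / 2 + ln ((1 + q t) / (1 - q t)) / 2)"
  define S where "S = 2 * s / (1 + s\<^sup>2)"
  have sq: "0 < (p t)\<^sup>2 - 1" "0 < 1 - (q t)\<^sup>2"
    using assms(1-3) by (simp_all add: power2_eq_square[of "p t"] less_1_mult abs_square_less_1)
  have dp: "((\<lambda>t. ln ((p t - 1) / (p t + 1)) / 2) has_real_derivative p' / ((p t)\<^sup>2 - 1)) (at t)"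
  proof -
    have "((\<lambda>t. (ln (p t - 1) - ln (p t + 1)) / 2) has_real_derivative
        (p' / (p t - 1) - p' / (p t + 1)) / 2) (at t)"
      using assms(1) by (auto intro!: derivative_eq_intros p simp: mult.commute)
    moreover have "(p' / (p t - 1) - p' / (p t + 1)) / 2 = p' / ((p t)\<^sup>2 - 1)"
      using assms(1) sq by (simp add: field_simps power2_eq_square)
    moreover have ev: "\<forall>\<^sub>F x in nhds t. (ln (p x - 1) - ln (p x + 1)) / 2 = ln ((p x - 1) / (p x + 1)) / 2"
    proof -
      have "\<forall>\<^sub>F x in at t. p x > 1"
        using DERIV_isCont[OF p] assms(1) by (simp add: isCont_def order_tendsto_iff)
      then have "\<forall>\<^sub>F x in nhds t. p x > 1"
        using assms(1) by (simp add: eventually_nhds_conv_at)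
      then show ?thesis by eventually_elim (simp add: ln_div)
    qed
    ultimately show ?thesis using DERIV_cong_ev[OF refl ev refl] by simp
  qed
  have dq: "((\<lambda>t. ln ((1 + q t) / (1 - q t)) / 2) has_real_derivative q' / (1 - (q t)\<^sup>2)) (at t)"
  proof -
    have "((\<lambda>t. (ln (1 + q t) - ln (1 - q t)) / 2) has_real_derivative
        (q' / (1 + q t) + q' / (1 - q t)) / 2) (at t)"
      using assms(2,3) by (auto intro!: derivative_eq_intros q simp: mult.commute)
    moreover have "(q' / (1 + q t) + q' / (1 - q t)) / 2 = q' / (1 - (q t)\<^sup>2)"
      using assms(2,3) sq by (simp add: field_simps power2_eq_square)
    moreover have ev: "\<forall>\<^sub>F x in nhds t. (ln (1 + q x) - ln (1 - q x)) / 2 = ln ((1 + q x) / (1 - q x)) / 2"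
    proof -
      have "\<forall>\<^sub>F x in at t. q x > -1 \<and> q x < 1"
        using DERIV_isCont[OF q] assms(2,3)
        by (auto simp: isCont_def order_tendsto_iff intro: eventually_conj)
      then have "\<forall>\<^sub>F x in nhds t. q x > -1 \<and> q x < 1"
        using assms(2,3) by (simp add: eventually_nhds_conv_at)
      then show ?thesis by eventually_elim (simp add: ln_div)
    qed
    ultimately show ?thesis using DERIV_cong_ev[OF refl ev refl] by simp
  qed
  define D where "D = S / ((p t)\<^sup>2 - 1) * p' + S / (1 - (q t)\<^sup>2) * q'"
  have "((\<lambda>t. radial (p t) (q t)) has_real_derivative
      2 * (inverse (1 + s\<^sup>2) * (s * (p' / ((p t)\<^sup>2 - 1) + q' / (1 - (q t)\<^sup>2))))) (at t)"
    unfolding radial_def s_def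
    by (intro DERIV_cmult DERIV_chain2[OF DERIV_arctan] DERIV_chain2[OF DERIV_exp] DERIV_add dp dq)
  moreover have "2 * (inverse (1 + s\<^sup>2) * (s * (p' / ((p t)\<^sup>2 - 1) + q' / (1 - (q t)\<^sup>2)))) = D"
    by (simp add: D_def S_def divide_inverse algebra_simps)
  ultimately have der: "((\<lambda>t. radial (p t) (q t)) has_real_derivative D) (at t)" by simp
  have "S \<ge> 0" by (simp add: S_def s_def)
  then have "2 * sqrt (p' * q') * sqrt (S / ((p t)\<^sup>2 - 1) * (S / (1 - (q t)\<^sup>2))) \<le> D"
    unfolding D_def using sq assms(6,7) by (intro weighted_sum_ge_geometric_mean) auto
  moreover have "sqrt (S / ((p t)\<^sup>2 - 1) * (S / (1 - (q t)\<^sup>2))) = 1 / (p t - q t)"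
    using radial_slope[OF assms(1-3) S_def s_def] assms(1-3) by (simp add: real_sqrt_divide)
  ultimately show ?thesis using der by auto
qed

text \<open>Away from \<open>p = 1\<close> and \<open>q = \<plusminus>1\<close> the derivatives \<open>1 / (p\<^sup>2 - 1)\<close> and \<open>1 / (1 - q\<^sup>2)\<close> of the two separated
  summands are bounded.\<close>

lemma radial_lipschitz:
  fixes p q :: "real \<Rightarrow> real"
  assumes "c < 1" "1 < C"
    and p: "Lp-lipschitz_on X p" "\<And>t. t \<in> X \<Longrightarrow> C \<le> p t"
    and q: "Lq-lipschitz_on X q" "\<And>t. t \<in> X \<Longrightarrow> -c \<le> q t \<and> q t \<le> c"
  shows "\<exists>L. L-lipschitz_on X (\<lambda>t. radial (p t) (q t))"
proof -
  have C2: "0 < C\<^sup>2 - 1" using assms(2) by (simp add: power2_eq_square less_1_mult)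
  have "(1 / (C\<^sup>2 - 1))-lipschitz_on {C..} (\<lambda>x. ln ((x - 1) / (x + 1)) / 2)"
  proof (rule lipschitz_on_bounded_derivative)
    fix x :: real assume x: "x \<in> {C..}"
    then have x2: "C\<^sup>2 \<le> x\<^sup>2" using assms(2) by (intro power_mono) auto
    show "((\<lambda>x. ln ((x - 1) / (x + 1)) / 2) has_real_derivative 1 / (x\<^sup>2 - 1)) (at x)"
      using x assms(2) x2 C2
      by (auto intro!: derivative_eq_intros simp: divide_simps power2_eq_square) (auto simp: algebra_simps)
    show "\<bar>1 / (x\<^sup>2 - 1)\<bar> \<le> 1 / (C\<^sup>2 - 1)" using x2 C2 by (simp add: frac_le)
  qed (use C2 in auto)
  then have "(1 / (C\<^sup>2 - 1))-lipschitz_on (p ` X) (\<lambda>x. ln ((x - 1) / (x + 1)) / 2)"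
    by (rule lipschitz_on_subset) (use p(2) in auto)
  note 1 = lipschitz_on_compose2[OF p(1) this]
  have 2: "\<exists>L. L-lipschitz_on X (\<lambda>t. ln ((1 + q t) / (1 - q t)) / 2)"
  proof (cases "X = {}")
    case True
    then show ?thesis by (auto intro: exI[of _ 0])
  next
    case False
    then have "c \<ge> 0" using q(2) by force
    then have c2: "0 < 1 - c\<^sup>2" using assms(1) by (simp add: abs_square_less_1)
    have "(1 / (1 - c\<^sup>2))-lipschitz_on {-c..c} (\<lambda>x. ln ((1 + x) / (1 - x)) / 2)"
    proof (rule lipschitz_on_bounded_derivative)
      fix x :: real assume x: "x \<in> {-c..c}"
      then have "\<bar>x\<bar> \<le> \<bar>c\<bar>" by auto
      then have x2: "x\<^sup>2 \<le> c\<^sup>2" by (simp add: abs_le_square_iff)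
      show "((\<lambda>x. ln ((1 + x) / (1 - x)) / 2) has_real_derivative 1 / (1 - x\<^sup>2)) (at x)"
        using x assms(1) x2 c2
        by (auto intro!: derivative_eq_intros simp: divide_simps power2_eq_square) (auto simp: algebra_simps)
      show "\<bar>1 / (1 - x\<^sup>2)\<bar> \<le> 1 / (1 - c\<^sup>2)" using x2 c2 by (simp add: frac_le)
    qed (use c2 in auto)
    then have "(1 / (1 - c\<^sup>2))-lipschitz_on (q ` X) (\<lambda>x. ln ((1 + x) / (1 - x)) / 2)"
      by (rule lipschitz_on_subset) (use q(2) in auto)
    from lipschitz_on_compose2[OF q(1) this] show ?thesis by blast
  qed
  then obtain L where "L-lipschitz_on X (\<lambda>t. ln ((1 + q t) / (1 - q t)) / 2)" by blast
  note 3 = lipschitz_on_add[OF 1 this]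
  have "1-lipschitz_on UNIV (\<lambda>x::real. 2 * arctan (exp x))"
  proof (rule lipschitz_on_bounded_derivative)
    fix x :: real
    show "((\<lambda>x. 2 * arctan (exp x)) has_real_derivative 2 * exp x / (1 + (exp x)\<^sup>2)) (at x)"
      by (auto intro!: derivative_eq_intros simp: divide_inverse)
    have "0 \<le> (exp x - 1)\<^sup>2" by simp
    then have "2 * exp x \<le> 1 + (exp x)\<^sup>2" by (simp add: power2_diff)
    moreover have "0 < 1 + (exp x)\<^sup>2" by (simp add: add_pos_nonneg)
    ultimately show "\<bar>2 * exp x / (1 + (exp x)\<^sup>2)\<bar> \<le> 1" by simp
  qed auto
  then have "1-lipschitz_on ((\<lambda>t. ln ((p t - 1) / (p t + 1)) / 2 + ln ((1 + q t) / (1 - q t)) / 2) ` X)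
      (\<lambda>x::real. 2 * arctan (exp x))"
    by (rule lipschitz_on_subset) auto
  from lipschitz_on_compose2[OF 3 this] show ?thesis unfolding radial_def by blast
qed

section \<open>The upper bound for lengths\<close>

text \<open>Replacing \<open>(p, q)\<close> by \<open>(p / r, r q)\<close> with \<open>r < 1\<close> moves the whole curve into the region where
  \<open>radial\<close> is Lipschitz and leaves \<open>p' q'\<close> unchanged. It enlarges \<open>p - q\<close> at most by a factor \<open>K r\<close>
  that tends to \<open>1\<close> with \<open>r\<close>, because \<open>p - q\<close> is bounded below on the compact curve.\<close>

lemma null_dist_length_bound:
  fixes p q f :: "real \<Rightarrow> real"
  assumes T: "0 \<le> T" and lip: "Lp-lipschitz_on {0..T} p" "Lq-lipschitz_on {0..T} q"
    and start: "p 0 = 1" "q 0 = -1" and "q T \<le> 1"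
    and pq: "\<And>t. t \<in> {0..T} \<Longrightarrow> q t < p t"
    and ae: "AE t in lebesgue_on {0..T}. \<exists>p' q'. (p has_real_derivative p') (at t)
      \<and> (q has_real_derivative q') (at t) \<and> 0 \<le> p' \<and> 0 \<le> q'
      \<and> f t = 2 * sqrt (p' * q') / (p t - q t)"
  shows "integral\<^sup>L (lebesgue_on {0..T}) f \<le> null_dist (p T) (q T)"
proof -
  have mono: "g u \<le> g v" if g: "g = p \<or> g = q" and uv: "0 \<le> u" "u \<le> v" "v \<le> T" for g u v
  proof -
    have sub: "{u..v} \<subseteq> {0..T}" using uv by auto
    obtain L where L: "L-lipschitz_on {u..v} g"
      using lipschitz_on_subset[OF lip(1) sub] lipschitz_on_subset[OF lip(2) sub] g by blast
    have "AE t in lebesgue_on {0..T}. \<exists>D. (g has_real_derivative D) (at t) \<and> 0 \<le> D"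
      using ae by eventually_elim (use g in auto)
    from lipschitz_nondecreasing[OF L uv(2) AE_lebesgue_on_subinterval[OF this sub]]
    show ?thesis .
  qed
  have p_ge: "1 \<le> p t" "p t \<le> p T" and q_ge: "-1 \<le> q t" "q t \<le> 1" if "t \<in> {0..T}" for t
    using mono[of p 0 t] mono[of p t T] mono[of q 0 t] mono[of q t T] that start \<open>q T \<le> 1\<close> by auto
  have pT: "1 \<le> p T" "-1 \<le> q T" "q T < p T" using p_ge q_ge pq T by auto
  have "continuous_on {0..T} (\<lambda>t. p t - q t)"
    using lip by (intro continuous_intros lipschitz_on_continuous_on)
  then obtain s where s: "s \<in> {0..T}" "\<And>t. t \<in> {0..T} \<Longrightarrow> p s - q s \<le> p t - q t"
    using continuous_attains_inf[of "{0..T}" "\<lambda>t. p t - q t"] T by fastforce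
  define m where "m = p s - q s"
  have m: "0 < m" "\<And>t. t \<in> {0..T} \<Longrightarrow> m \<le> p t - q t"
    using s pq by (auto simp: m_def)
  define K where "K r = 1 + ((1 / r - 1) * p T + (1 - r)) / m" for r
  have key: "integral\<^sup>L (lebesgue_on {0..T}) f \<le> K r * null_dist (p T / r) (r * q T)"
    if r: "0 < r" "r < 1" for r
  proof -
    define P where "P t = p t / r" for t
    define Q where "Q t = r * q t" for t
    have r1: "1 < 1 / r" using r by simp
    have P: "1 / r \<le> P t" and Q: "-r \<le> Q t" "Q t \<le> r" if "t \<in> {0..T}" for t
      using p_ge[OF that] q_ge[OF that] r
        mult_left_mono[of "-1" "q t" r] mult_left_mono[of "q t" 1 r]
      by (auto simp: P_def Q_def divide_right_mono)
    have K: "0 < K r" unfolding K_def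
      using r r1 m pT by (intro add_pos_nonneg divide_nonneg_pos) auto
    have KPQ: "P t - Q t \<le> K r * (p t - q t)" if t: "t \<in> {0..T}" for t
    proof -
      have "P t - Q t = (p t - q t) + ((1 / r - 1) * p t + (1 - r) * q t)"
        by (simp add: P_def Q_def algebra_simps)
      also have "(1 / r - 1) * p t + (1 - r) * q t \<le> (1 / r - 1) * p T + (1 - r) * 1"
        using p_ge[OF t] q_ge[OF t] r r1 by (intro add_mono mult_left_mono) auto
      also have "(1 / r - 1) * p T + (1 - r) * 1
          = ((1 / r - 1) * p T + (1 - r)) / m * m" using m(1) by simp
      also have "\<dots> \<le> ((1 / r - 1) * p T + (1 - r)) / m * (p t - q t)"
        using m t r r1 pT by (intro mult_left_mono divide_nonneg_pos) auto
      finally show ?thesis by (simp add: K_def algebra_simps)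
    qed
    \<comment> \<open>The calibration inequality for \<open>(P, Q)\<close>, scaled by \<open>K r\<close>, dominates the speed of \<open>(p, q)\<close>.\<close>
    have "(1 / r * Lp)-lipschitz_on {0..T} P" "(r * Lq)-lipschitz_on {0..T} Q"
      using lipschitz_on_cmult_real_nonneg[OF lip(1), of "1 / r"]
        lipschitz_on_cmult_real_nonneg[OF lip(2), of r] r
      by (simp_all add: P_def[abs_def] Q_def[abs_def])
    then obtain L where "L-lipschitz_on {0..T} (\<lambda>t. radial (P t) (Q t))"
      using radial_lipschitz[of r "1 / r" _ "{0..T}" P _ Q] r r1 P Q by blast
    then have lipK: "(K r * L)-lipschitz_on {0..T} (\<lambda>t. K r * radial (P t) (Q t))"
      using K by (intro lipschitz_on_cmult_real_nonneg) auto
    have "AE t in lebesgue_on {0..T}. t \<in> {0..T}"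
      by (simp add: AE_restrict_space_iff)
    with ae have "AE t in lebesgue_on {0..T}. \<exists>D. ((\<lambda>t. K r * radial (P t) (Q t)) has_real_derivative D) (at t)
        \<and> 0 \<le> f t \<and> f t \<le> D"
    proof eventually_elim
      case (elim t)
      then obtain p' q' where d: "(p has_real_derivative p') (at t)"
        "(q has_real_derivative q') (at t)" "0 \<le> p'" "0 \<le> q'"
        and f: "f t = 2 * sqrt (p' * q') / (p t - q t)" by blast
      note t = elim(2)
      have "(P has_real_derivative p' / r) (at t)" "(Q has_real_derivative r * q') (at t)"
        unfolding P_def[abs_def] Q_def[abs_def]
        using d r by (auto intro!: derivative_eq_intros)
      moreover have "1 < P t" "-1 < Q t" "Q t < 1" using P[OF t] Q[OF t] r r1 by linarith+
      ultimately obtain D where D: "((\<lambda>t. radial (P t) (Q t)) has_real_derivative D) (at t)"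
        "2 * sqrt (p' / r * (r * q')) / (P t - Q t) \<le> D"
        using radial_derivative_ge[of P t Q "p' / r" "r * q'"] d(3,4) r by auto
      have "((\<lambda>t. K r * radial (P t) (Q t)) has_real_derivative K r * D) (at t)"
        by (intro DERIV_cmult D)
      moreover have "f t \<le> K r * (2 * sqrt (p' * q') / (P t - Q t))"
      proof -
        have "0 < P t - Q t" using \<open>1 < P t\<close> \<open>Q t < 1\<close> by simp
        then show ?thesis
          using KPQ[OF t] pq[OF t] d(3,4) mult_left_mono[OF KPQ[OF t], of "sqrt (p' * q')"]
          by (simp add: f divide_simps mult_ac)
      qed
      moreover have "K r * (2 * sqrt (p' * q') / (P t - Q t)) \<le> K r * D"
        using D(2) K r by (intro mult_left_mono) auto
      moreover have "0 \<le> f t" using d(3,4) pq[OF t] by (simp add: f)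
      ultimately show ?case by (meson order_trans)
    qed
    from lebesgue_integral_le_increment[OF lipK T this]
    have "integral\<^sup>L (lebesgue_on {0..T}) f \<le> K r * (radial (P T) (Q T) - radial (P 0) (Q 0))"
      by (simp add: algebra_simps)
    also have "\<dots> \<le> K r * radial (P T) (Q T)"
      using K by (simp add: radial_def)
    also have "radial (P T) (Q T) = null_dist (p T / r) (r * q T)"
    proof -
      have "T \<in> {0..T}" using T by simp
      then have "1 < P T" "-1 < Q T" "Q T < 1" using P[of T] Q[of T] r r1 by linarith+
      then show ?thesis by (simp add: radial_eq_null_dist) (simp add: P_def Q_def)
    qed
    finally show ?thesis .
  qed
  have lim_arg: "((\<lambda>r. (1 - p T * q T) / (p T / r - r * q T)) \<longlongrightarrow>
      (1 - p T * q T) / (p T / 1 - 1 * q T)) (at_left 1)"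
    using pT by (intro tendsto_intros) auto
  have ev: "\<forall>\<^sub>F r::real in at_left 1. 0 < r \<and> r < 1"
    by (rule eventually_at_leftI[of 0]) auto
  have "((\<lambda>r. K r * null_dist (p T / r) (r * q T)) \<longlongrightarrow> K 1 * null_dist (p T) (q T)) (at_left 1)"
  proof (intro tendsto_mult)
    show "(K \<longlongrightarrow> K 1) (at_left 1)"
      unfolding K_def[abs_def] using m by (auto intro!: tendsto_eq_intros)
    have "((\<lambda>r. arccos ((1 - p T * q T) / (p T / r - r * q T))) \<longlongrightarrow>
        arccos ((1 - p T * q T) / (p T / 1 - 1 * q T))) (at_left 1)"
    proof (rule continuous_on_tendsto_compose[OF continuous_on_arccos' lim_arg])
      show "(1 - p T * q T) / (p T / 1 - 1 * q T) \<in> {-1..1}"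
        using null_dist_arg_bounds[of "p T" "q T"] pT \<open>q T \<le> 1\<close> by simp
      show "\<forall>\<^sub>F r in at_left 1. (1 - p T * q T) / (p T / r - r * q T) \<in> {-1..1}"
        using ev
      proof eventually_elim
        case (elim r)
        have "1 \<le> p T / r" "\<bar>r * q T\<bar> < 1"
          using elim pT \<open>q T \<le> 1\<close> mult_strict_mono'[of r 1 "\<bar>q T\<bar>" 1]
          by (auto simp: abs_mult le_divide_eq intro: le_less_trans[OF mult_left_le])
        then have "-1 \<le> r * q T" "r * q T \<le> 1" "r * q T < p T / r" by linarith+
        then show ?case
          using null_dist_arg_bounds[of "p T / r" "r * q T"] \<open>1 \<le> p T / r\<close> elim by simp
      qed
    qed
    then show "((\<lambda>r. null_dist (p T / r) (r * q T)) \<longlongrightarrow> null_dist (p T) (q T)) (at_left 1)"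
      using ev by (auto simp: null_dist_def elim!: Lim_transform_eventually eventually_mono)
  qed
  moreover have "K 1 = 1" by (simp add: K_def)
  ultimately have "((\<lambda>r. K r * null_dist (p T / r) (r * q T)) \<longlongrightarrow> null_dist (p T) (q T)) (at_left 1)"
    by simp
  then show ?thesis
    by (rule tendsto_lowerbound) (use ev in \<open>auto elim!: eventually_mono intro: key\<close>)
qed

section \<open>Closed forms of the distance\<close>

text \<open>The left-hand side is the value that the antiderivative of the speed along the geodesic from
  \<open>(1, -1)\<close> to \<open>(p, q)\<close> yields. Both sides lie in \<open>(0, \<pi>)\<close>, so it suffices to compare cosines; the
  addition theorem gives the square of the cosine of half the angle as a rational function.\<close>

lemma geodesic_arctan_difference:
  fixes p q :: real
  assumes "1 < p" "-1 < q" "q < 1"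
  defines "\<alpha> \<equiv> 1 + p * q" and "\<gamma> \<equiv> p + q" and "\<kappa> \<equiv> sqrt ((p + q)\<^sup>2 - (1 + p * q)\<^sup>2)"
  shows "2 * arctan ((\<gamma> * p - \<alpha>) / \<kappa>) - 2 * arctan ((\<gamma> - \<alpha>) / \<kappa>) = null_dist p q"
proof -
  have \<gamma>: "0 < \<gamma>" using assms by simp
  have k2: "(p + q)\<^sup>2 - (1 + p * q)\<^sup>2 = (p\<^sup>2 - 1) * (1 - q\<^sup>2)"
    by (simp add: power2_eq_square algebra_simps)
  have "0 < (p\<^sup>2 - 1) * (1 - q\<^sup>2)"
    using assms(1-3) by (simp add: power2_eq_square[of p] less_1_mult abs_square_less_1)
  then have \<kappa>: "0 < \<kappa>" "\<kappa>\<^sup>2 = \<gamma>\<^sup>2 - \<alpha>\<^sup>2"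
    by (simp_all add: \<kappa>_def k2 \<gamma>_def \<alpha>_def)
  define U where "U = \<gamma> * p - \<alpha>"
  define V where "V = \<gamma> - \<alpha>"
  have V: "V = (p - 1) * (1 - q)" by (simp add: V_def \<gamma>_def \<alpha>_def algebra_simps)
  have V0: "0 < V" using assms(1-3) by (simp add: V)
  have UV: "V < U" using \<gamma> assms(1) by (simp add: U_def V_def)
  define u where "u = arctan (U / \<kappa>)"
  define v where "v = arctan (V / \<kappa>)"
  have uv: "0 < v" "v < u" "u < pi / 2"
    using V0 UV \<kappa>(1) arctan_ubound by (auto simp: u_def v_def divide_strict_right_mono arctan_less_iff)
  have e1: "\<kappa>\<^sup>2 + U\<^sup>2 = \<gamma> * ((p\<^sup>2 - 1) * (p - q))"
    unfolding \<kappa>(2) U_def \<gamma>_def \<alpha>_def by (simp add: power2_eq_square algebra_simps)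
  have e2: "\<kappa>\<^sup>2 + V\<^sup>2 = \<gamma> * (2 * (p - 1) * (1 - q))"
    unfolding \<kappa>(2) V_def \<gamma>_def \<alpha>_def by (simp add: power2_eq_square algebra_simps)
  have e3: "\<kappa>\<^sup>2 + U * V = \<gamma> * ((p\<^sup>2 - 1) * (1 - q))"
    unfolding \<kappa>(2) U_def V_def \<gamma>_def \<alpha>_def by (simp add: power2_eq_square algebra_simps)
  have scale: "1 + (x / \<kappa>)\<^sup>2 = (\<kappa>\<^sup>2 + x\<^sup>2) / \<kappa>\<^sup>2" for x
    using \<kappa>(1) by (simp add: power_divide field_simps)
  have pos: "0 < 1 + (x / \<kappa>)\<^sup>2" for x by (simp add: add_pos_nonneg)
  have "cos (u - v) = (1 + U / \<kappa> * (V / \<kappa>)) / (sqrt (1 + (U / \<kappa>)\<^sup>2) * sqrt (1 + (V / \<kappa>)\<^sup>2))"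
    by (simp add: u_def v_def cos_diff cos_arctan sin_arctan add_divide_distrib)
  then have "(cos (u - v))\<^sup>2 = (1 + U / \<kappa> * (V / \<kappa>))\<^sup>2 / ((1 + (U / \<kappa>)\<^sup>2) * (1 + (V / \<kappa>)\<^sup>2))"
    using pos[of U] pos[of V] by (simp add: power_divide power_mult_distrib)
  also have "1 + U / \<kappa> * (V / \<kappa>) = (\<kappa>\<^sup>2 + U * V) / \<kappa>\<^sup>2"
    using \<kappa>(1) by (simp add: power2_eq_square field_simps)
  also have "((\<kappa>\<^sup>2 + U * V) / \<kappa>\<^sup>2)\<^sup>2 / ((1 + (U / \<kappa>)\<^sup>2) * (1 + (V / \<kappa>)\<^sup>2))
      = (\<kappa>\<^sup>2 + U * V)\<^sup>2 / ((\<kappa>\<^sup>2 + U\<^sup>2) * (\<kappa>\<^sup>2 + V\<^sup>2))"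
    unfolding scale using \<kappa>(1) by (simp add: power_divide power2_eq_square)
  also have "\<dots> = (p + 1) * (1 - q) / (2 * (p - q))"
  proof -
    have "(g * (b * c * z))\<^sup>2 / (g * (b * c * d) * (g * (2 * c * z))) = b * z / (2 * d)"
      if "g \<noteq> 0" "b \<noteq> 0" "z \<noteq> 0" "d \<noteq> 0" "c \<noteq> 0" for g b c z d :: real
      using that by (simp add: power2_eq_square)
    from this[of \<gamma> "p + 1" "1 - q" "p - q" "p - 1"] show ?thesis
      unfolding e1 e2 e3 using \<gamma> assms(1-3) by (simp add: power2_eq_square square_diff_one_factored)
  qed
  finally have "cos (2 * (u - v)) = 2 * ((p + 1) * (1 - q) / (2 * (p - q))) - 1"
    by (simp only: cos_double_cos)
  also have "\<dots> = (1 - p * q) / (p - q)"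
    using assms(1-3) by (simp add: field_simps)
  finally have "null_dist p q = arccos (cos (2 * (u - v)))" by (simp add: null_dist_def)
  also have "\<dots> = 2 * (u - v)" using uv by (intro arccos_cos) auto
  finally show ?thesis by (simp add: u_def v_def U_def V_def)
qed

text \<open>Both arcsines have a cosine proportional to the square root of the same quantity \<open>S\<close>. The difference of
  the angles is at most \<open>\<pi>\<close> in absolute value and has positive sine, so it lies in \<open>(0, \<pi>)\<close> and is
  determined by its cosine.\<close>

lemma arcsin_difference_eq_null_dist:
  fixes w y :: real
  assumes "0 < y" "\<bar>y - 1\<bar> < w" "w < y + 1"
  shows "arcsin ((y\<^sup>2 + w\<^sup>2 - 1) / (2 * y * w)) - arcsin ((y\<^sup>2 - w\<^sup>2 - 1) / (2 * w))
    = null_dist (w + y) (w - y)" (is "arcsin ?a - arcsin ?b = _")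
proof -
  have w: "0 < w" using assms by auto
  define S where "S = ((w + y)\<^sup>2 - 1) * (1 - (w - y)\<^sup>2)"
  have S: "0 < S"
    using assms unfolding S_def
    by (intro mult_pos_pos) (auto simp: one_less_power abs_square_less_1)
  have Sa: "S = (2 * y * w)\<^sup>2 - (y\<^sup>2 + w\<^sup>2 - 1)\<^sup>2" and Sb: "S = (2 * w)\<^sup>2 - (y\<^sup>2 - w\<^sup>2 - 1)\<^sup>2"
    by (simp_all add: S_def power2_eq_square algebra_simps)
  have unit: "1 - (x / z)\<^sup>2 = (z\<^sup>2 - x\<^sup>2) / z\<^sup>2" if "z \<noteq> 0" for x z :: real
    using that by (simp add: power_divide diff_divide_distrib)
  have a: "1 - ?a\<^sup>2 = S / (2 * y * w)\<^sup>2"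
    unfolding Sa using w assms(1) by (intro unit) auto
  have b: "1 - ?b\<^sup>2 = S / (2 * w)\<^sup>2"
    unfolding Sb using w by (intro unit) auto
  have "?a\<^sup>2 \<le> 1" "?b\<^sup>2 \<le> 1"
    using a b S zero_le_divide_iff[of S] by (smt (verit) zero_le_power2)+
  then have ab: "-1 \<le> ?a" "?a \<le> 1" "-1 \<le> ?b" "?b \<le> 1"
    unfolding abs_square_le_1 by linarith+
  have ca: "cos (arcsin ?a) = sqrt S / (2 * y * w)" and cb: "cos (arcsin ?b) = sqrt S / (2 * w)"
    using ab w assms(1) by (simp_all only: cos_arcsin a b real_sqrt_divide real_sqrt_abs) simp_all
  define d where "d = arcsin ?a - arcsin ?b"
  have "sin d = ?a * (sqrt S / (2 * w)) - sqrt S / (2 * y * w) * ?b"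
    using ab by (simp only: d_def sin_diff ca cb sin_arcsin)
  also have "\<dots> = sqrt S / (2 * y * w) * (?a * y - ?b)"
  proof -
    have "a * (r / (2 * w)) - r / (2 * y * w) * b = r / (2 * y * w) * (a * y - b)" for a b r :: real
      using w assms(1) by (simp add: field_simps)
    then show ?thesis .
  qed
  also have "?a * y - ?b = w"
    using w assms(1) by (simp add: field_simps power2_eq_square)
  finally have "0 < sin d" using S w assms(1) by simp
  moreover have "-pi \<le> d" "d \<le> pi"
    using arcsin_bounded[of ?a] arcsin_bounded[of ?b] ab unfolding d_def by linarith+
  ultimately have d: "0 \<le> d"
    using sin_ge_zero[of "-d"] by (smt (verit) sin_minus)
  have "cos d = sqrt S / (2 * y * w) * (sqrt S / (2 * w)) + ?a * ?b"
    using ab ca cb by (simp add: d_def cos_diff)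
  also have "\<dots> = (S + (y\<^sup>2 + w\<^sup>2 - 1) * (y\<^sup>2 - w\<^sup>2 - 1)) / (4 * y * w\<^sup>2)"
    using S by (simp add: add_divide_distrib power2_eq_square)
  also have "S + (y\<^sup>2 + w\<^sup>2 - 1) * (y\<^sup>2 - w\<^sup>2 - 1) = 2 * w\<^sup>2 * (1 + y\<^sup>2 - w\<^sup>2)"
    unfolding Sb by (simp add: power2_eq_square algebra_simps)
  also have "2 * w\<^sup>2 * (1 + y\<^sup>2 - w\<^sup>2) / (4 * y * w\<^sup>2) = (1 - (w + y) * (w - y)) / (w + y - (w - y))"
    using w assms(1) by (simp add: field_simps power2_eq_square)
  finally have "null_dist (w + y) (w - y) = arccos (cos d)" by (simp add: null_dist_def)
  also have "\<dots> = d" using d \<open>d \<le> pi\<close> by (intro arccos_cos)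
  finally show ?thesis by (simp add: d_def)
qed

section \<open>Null coordinates on the group\<close>

text \<open>The null coordinates \<open>w + y\<close> and \<open>w - y\<close> with \<open>w = (x - \<nu> (y - 1)) / \<lambda>\<close>, written so that their level
  lines through the identity are visibly the zero sets of \<open>lambda2\<close> and \<open>lambda1\<close>. That they are these
  coordinates is \<open>null_p_minus_q\<close> together with \<open>time_eq_null_mean\<close>.\<close>

definition null_p :: "real^2^2 \<Rightarrow> real \<times> real \<Rightarrow> real" where
  "null_p A z = 1 + (A$1$1 - A$2$1) * lambda2 A z / det A"

definition null_q :: "real^2^2 \<Rightarrow> real \<times> real \<Rightarrow> real" where
  "null_q A z = -1 - (A$1$1 + A$2$1) * lambda1 A z / det A"

text \<open>The linear parts of \<open>null_p\<close> and \<open>null_q\<close>, acting on tangent vectors.\<close>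

definition null_dp :: "real^2^2 \<Rightarrow> real \<times> real \<Rightarrow> real" where
  "null_dp A h = (A$1$1 - A$2$1) * ((A$2$1 + A$1$1) * fst h + (A$2$2 + A$1$2) * snd h) / det A"

definition null_dq :: "real^2^2 \<Rightarrow> real \<times> real \<Rightarrow> real" where
  "null_dq A h = - ((A$1$1 + A$2$1) * ((A$2$1 - A$1$1) * fst h + (A$2$2 - A$1$2) * snd h) / det A)"

definition lor_speed :: "real^2^2 \<Rightarrow> (real \<Rightarrow> real \<times> real) \<Rightarrow> real \<Rightarrow> real" where
  "lor_speed A \<gamma> t =
    (let v = A *v frame_coords (\<gamma> t) (vector_derivative \<gamma> (at t)) in sqrt ((v$1)\<^sup>2 - (v$2)\<^sup>2))"

lemma null_p_id [simp]: "null_p A aff_id = 1" and null_q_id [simp]: "null_q A aff_id = -1"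
  by (simp_all add: null_p_def null_q_def aff_id_def lambda1_def lambda2_def)

lemma matrix_inv_2:
  fixes A :: "real^2^2"
  assumes "det A \<noteq> 0"
  shows "matrix_inv A $ 1 $ 1 = A$2$2 / det A" "matrix_inv A $ 1 $ 2 = - A$1$2 / det A"
    "matrix_inv A $ 2 $ 1 = - A$2$1 / det A" "matrix_inv A $ 2 $ 2 = A$1$1 / det A"
proof -
  define C :: "real^2^2" where
    "C = vector [vector [A$2$2 / det A, - A$1$2 / det A], vector [- A$2$1 / det A, A$1$1 / det A]]"
  have "A$1$1 * A$2$2 / det A - A$1$2 * A$2$1 / det A = 1"
    using assms by (simp add: det_2 diff_divide_distrib[symmetric])
  then have CA: "C ** A = mat 1"
    by (auto simp: C_def vec_eq_iff forall_2 matrix_matrix_mult_def sum_2 mat_def mult_ac)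
  have "invertible A" using assms by (simp add: invertible_det_nz)
  then have "A ** matrix_inv A = mat 1"
    unfolding invertible_def matrix_inv_def by (rule someI2_ex) simp
  then have "matrix_inv A = C"
    using CA by (metis matrix_mul_assoc matrix_mul_lid matrix_mul_rid)
  then show "matrix_inv A $ 1 $ 1 = A$2$2 / det A" "matrix_inv A $ 1 $ 2 = - A$1$2 / det A"
    "matrix_inv A $ 2 $ 1 = - A$2$1 / det A" "matrix_inv A $ 2 $ 2 = A$1$1 / det A"
    by (simp_all add: C_def)
qed

text \<open>By the curvature formula \<open>K = (c\<^sup>2 - a\<^sup>2) / |A|\<^sup>2\<close>, the second condition is what \<open>K < 0\<close> and \<open>a \<ge> 0\<close> amount
  to.\<close>

locale negatively_curved =
  fixes A :: "real^2^2"
  assumes det_pos: "det A > 0" and first_dominates: "\<bar>A$2$1\<bar> < A$1$1"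
begin

lemma entry_signs: "0 < A$1$1 - A$2$1" "0 < A$1$1 + A$2$1"
  using first_dominates by linarith+

lemma Delta_eq: "Delta A = sqrt ((A$1$1 - A$2$1) * (A$1$1 + A$2$1)) / det A"
proof -
  have "(A$1$1 / det A)\<^sup>2 - (- A$2$1 / det A)\<^sup>2 = (A$1$1 - A$2$1) * (A$1$1 + A$2$1) / (det A)\<^sup>2"
    by (simp add: power_divide diff_divide_distrib[symmetric] power2_eq_square algebra_simps)
  then show ?thesis
    using det_pos by (simp add: Delta_def matrix_inv_2 real_sqrt_divide)
qed

lemma Delta_pos: "0 < Delta A"
  using entry_signs det_pos by (simp add: Delta_eq)

lemma lam_eq: "lam A = det A / ((A$1$1 - A$2$1) * (A$1$1 + A$2$1))"
  and nu_eq: "nu A = (A$2$1 * A$2$2 - A$1$1 * A$1$2) / ((A$1$1 - A$2$1) * (A$1$1 + A$2$1))"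
proof -
  have D2: "(Delta A)\<^sup>2 = (A$1$1 - A$2$1) * (A$1$1 + A$2$1) / (det A)\<^sup>2"
    using entry_signs by (simp add: Delta_eq power_divide)
  have "A$2$2 / det A * (A$1$1 / det A) - - A$1$2 / det A * (- A$2$1 / det A) = det A / (det A)\<^sup>2"
    by (simp add: det_2[of A] power2_eq_square diff_divide_distrib mult_ac)
  then show "lam A = det A / ((A$1$1 - A$2$1) * (A$1$1 + A$2$1))"
    using det_pos by (simp add: lam_def D2 matrix_inv_2)
  have "- A$1$2 / det A * (A$1$1 / det A) - A$2$2 / det A * (- A$2$1 / det A)
      = (A$2$1 * A$2$2 - A$1$1 * A$1$2) / (det A)\<^sup>2"
    by (simp add: power2_eq_square diff_divide_distrib mult_ac)
  then show "nu A = (A$2$1 * A$2$2 - A$1$1 * A$1$2) / ((A$1$1 - A$2$1) * (A$1$1 + A$2$1))"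
    using det_pos by (simp add: nu_def D2 matrix_inv_2)
qed

lemma null_dp_minus_dq: "null_dp A h - null_dq A h = 2 * snd h"
proof -
  have "null_dp A h - null_dq A h = 2 * (det A * snd h) / det A"
    unfolding null_dp_def null_dq_def diff_minus_eq_add add_divide_distrib[symmetric]
    by (simp add: det_2 algebra_simps)
  then show ?thesis using det_pos by simp
qed

lemma null_p_affine: "null_p A z = 1 + null_dp A (z - aff_id)"
  and null_q_affine: "null_q A z = -1 + null_dq A (z - aff_id)"
  by (simp_all add: null_p_def null_q_def null_dp_def null_dq_def lambda1_def lambda2_def aff_id_def)

lemma null_p_minus_q: "null_p A z - null_q A z = 2 * snd z"
  using null_dp_minus_dq[of "z - aff_id"] by (simp add: null_p_affine null_q_affine aff_id_def)

lemma linear_null_dp: "linear (null_dp A)" and linear_null_dq: "linear (null_dq A)"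
  by (auto intro!: linearI simp: null_dp_def null_dq_def algebra_simps add_divide_distrib diff_divide_distrib)

lemma null_p_has_derivative:
  assumes "(\<gamma> has_vector_derivative h) (at t)"
  shows "((\<lambda>t. null_p A (\<gamma> t)) has_real_derivative null_dp A h) (at t)"
    and "((\<lambda>t. null_q A (\<gamma> t)) has_real_derivative null_dq A h) (at t)"
proof -
  have "((\<lambda>t. \<gamma> t - aff_id) has_vector_derivative h) (at t)"
    using assms by (auto intro!: derivative_eq_intros)
  then have 1: "((\<lambda>t. null_dp A (\<gamma> t - aff_id)) has_vector_derivative null_dp A h) (at t)"
    and 2: "((\<lambda>t. null_dq A (\<gamma> t - aff_id)) has_vector_derivative null_dq A h) (at t)"
    using linear_null_dp linear_null_dq bounded_linear.has_vector_derivative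
    unfolding linear_conv_bounded_linear by blast+
  show "((\<lambda>t. null_p A (\<gamma> t)) has_real_derivative null_dp A h) (at t)"
    "((\<lambda>t. null_q A (\<gamma> t)) has_real_derivative null_dq A h) (at t)"
    using has_vector_derivative_add[OF has_vector_derivative_const[of 1] 1]
      has_vector_derivative_add[OF has_vector_derivative_const[of "-1"] 2]
    unfolding null_p_affine null_q_affine has_real_derivative_iff_has_vector_derivative add_0_left
    by blast+
qed

text \<open>The forms \<open>v\<^sub>1 + v\<^sub>2\<close> and \<open>v\<^sub>1 - v\<^sub>2\<close> are positive multiples of \<open>dp / y\<close> and \<open>dq / y\<close>. This is why \<open>p\<close> and
  \<open>q\<close> describe both the causal order and the length.\<close>

lemma velocity_sum: "z \<in> Aff \<Longrightarrow> (A *v frame_coords z h)$1 + (A *v frame_coords z h)$2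
    = det A / (A$1$1 - A$2$1) * null_dp A h / snd z"
  and velocity_diff: "z \<in> Aff \<Longrightarrow> (A *v frame_coords z h)$1 - (A *v frame_coords z h)$2
    = det A / (A$1$1 + A$2$1) * null_dq A h / snd z"
  using entry_signs det_pos
  by (simp_all add: Aff_def frame_coords_def matrix_vector_mult_def sum_2 null_dp_def null_dq_def
      divide_simps) (simp_all add: algebra_simps)

lemma future_causal_iff:
  assumes "z \<in> Aff"
  shows "future_causal A (frame_coords z h) \<longleftrightarrow> 0 \<le> null_dp A h \<and> 0 \<le> null_dq A h"
proof -
  let ?v = "A *v frame_coords z h"
  have "future_causal A (frame_coords z h) \<longleftrightarrow> 0 \<le> ?v$1 + ?v$2 \<and> 0 \<le> ?v$1 - ?v$2"
    by (auto simp: future_causal_def)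
  also have "\<dots> \<longleftrightarrow> 0 \<le> null_dp A h \<and> 0 \<le> null_dq A h"
  proof -
    have "0 \<le> k / l * x / y \<longleftrightarrow> 0 \<le> x" if "0 < k" "0 < l" "0 < y" for k l x y :: real
    proof -
      have "0 < k / l / y" using that by simp
      moreover have "k / l * x / y = k / l / y * x" by simp
      ultimately show ?thesis by (simp only: zero_le_mult_iff) linarith
    qed
    then show ?thesis
      unfolding velocity_sum[OF assms] velocity_diff[OF assms]
      using assms entry_signs det_pos by (simp add: Aff_def)
  qed
  finally show ?thesis .
qed

lemma lor_speed_eq:
  assumes "\<gamma> t \<in> Aff"
  defines "h \<equiv> vector_derivative \<gamma> (at t)"
  shows "lor_speed A \<gamma> t
    = 2 * sqrt (null_dp A h * null_dq A h) / (null_p A (\<gamma> t) - null_q A (\<gamma> t)) / Delta A"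
proof -
  let ?v = "A *v frame_coords (\<gamma> t) h"
  define m where "m = (A$1$1 - A$2$1) * (A$1$1 + A$2$1)"
  have m: "0 < m" using entry_signs by (simp add: m_def)
  have y: "0 < snd (\<gamma> t)" using assms(1) by (simp add: Aff_def)
  have "(?v$1)\<^sup>2 - (?v$2)\<^sup>2 = (?v$1 + ?v$2) * (?v$1 - ?v$2)"
    by (simp add: power2_eq_square algebra_simps)
  also have "\<dots> = (det A)\<^sup>2 / m * (null_dp A h * null_dq A h) / (snd (\<gamma> t))\<^sup>2"
    unfolding velocity_sum[OF assms(1)] velocity_diff[OF assms(1)]
    by (simp add: m_def power2_eq_square mult_ac)
  finally have "sqrt ((?v$1)\<^sup>2 - (?v$2)\<^sup>2) = det A / sqrt m * sqrt (null_dp A h * null_dq A h) / snd (\<gamma> t)"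
    using det_pos y by (simp add: real_sqrt_mult real_sqrt_divide)
  moreover have "lor_speed A \<gamma> t = sqrt ((?v$1)\<^sup>2 - (?v$2)\<^sup>2)"
    by (simp add: lor_speed_def Let_def h_def)
  ultimately show ?thesis
    using m y by (simp add: null_p_minus_q Delta_eq m_def[symmetric] mult_ac)
qed

lemma causal_curve_null_coords:
  assumes \<gamma>: "future_causal_curve A \<gamma> T"
  defines "p \<equiv> \<lambda>t. null_p A (\<gamma> t)" and "q \<equiv> \<lambda>t. null_q A (\<gamma> t)"
  shows "\<exists>L. L-lipschitz_on {0..T} p" "\<exists>L. L-lipschitz_on {0..T} q"
    and "\<And>t. t \<in> {0..T} \<Longrightarrow> q t < p t"
    and "AE t in lebesgue_on {0..T}. \<exists>p' q'. (p has_real_derivative p') (at t)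
      \<and> (q has_real_derivative q') (at t) \<and> 0 \<le> p' \<and> 0 \<le> q'
      \<and> Delta A * lor_speed A \<gamma> t = 2 * sqrt (p' * q') / (p t - q t)"
proof -
  from \<gamma> have T: "0 < T" and img: "\<And>t. t \<in> {0..T} \<Longrightarrow> \<gamma> t \<in> Aff"
    and ae: "AE t in lebesgue_on {0..T}. \<gamma> differentiable (at t) \<and>
        future_causal A (frame_coords (\<gamma> t) (vector_derivative \<gamma> (at t)))"
    by (auto simp: future_causal_curve_def)
  obtain C where C: "C-lipschitz_on {0..T} \<gamma>" using \<gamma> by (auto simp: future_causal_curve_def)
  have lip: "\<exists>L. L-lipschitz_on {0..T} (\<lambda>t. k + f (\<gamma> t - aff_id))"
    if f: "linear f" for f :: "real \<times> real \<Rightarrow> real" and k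
  proof -
    obtain B where B: "B > 0" "\<And>x. norm (f x) \<le> norm x * B"
      using bounded_linear.pos_bounded[of f] f by (auto simp: linear_conv_bounded_linear)
    have "B-lipschitz_on (\<gamma> ` {0..T}) (\<lambda>x. k + f (x - aff_id))"
    proof (rule lipschitz_onI)
      fix x y
      show "dist (k + f (x - aff_id)) (k + f (y - aff_id)) \<le> B * dist x y"
        using B(2)[of "x - y"] linear_diff[OF f, of "x - aff_id" "y - aff_id"]
        by (simp add: dist_norm mult.commute)
    qed (use B in simp)
    from lipschitz_on_compose2[OF C this] show ?thesis by blast
  qed
  show "\<exists>L. L-lipschitz_on {0..T} p" "\<exists>L. L-lipschitz_on {0..T} q"
    unfolding p_def q_def null_p_affine null_q_affine
    by (intro lip linear_null_dp linear_null_dq)+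
  show "q t < p t" if "t \<in> {0..T}" for t
    using img[OF that] null_p_minus_q[of "\<gamma> t"] by (simp add: p_def q_def Aff_def)
  have "AE t in lebesgue_on {0..T}. t \<in> {0..T}"
    by (simp add: AE_restrict_space_iff)
  with ae show "AE t in lebesgue_on {0..T}. \<exists>p' q'. (p has_real_derivative p') (at t)
      \<and> (q has_real_derivative q') (at t) \<and> 0 \<le> p' \<and> 0 \<le> q'
      \<and> Delta A * lor_speed A \<gamma> t = 2 * sqrt (p' * q') / (p t - q t)"
  proof eventually_elim
    case (elim t)
    define h where "h = vector_derivative \<gamma> (at t)"
    have h: "(\<gamma> has_vector_derivative h) (at t)"
      using elim(1) by (simp add: h_def vector_derivative_works)
    have "0 \<le> null_dp A h" "0 \<le> null_dq A h"
      using elim future_causal_iff[OF img] by (auto simp: h_def)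
    then show ?case
      using null_p_has_derivative[OF h] lor_speed_eq[of \<gamma> t] img[OF elim(2)] Delta_pos
      unfolding p_def q_def h_def[symmetric] by fastforce
  qed
qed

lemma lor_length_eq_integral_speed:
  "lor_length A \<gamma> T = integral\<^sup>L (lebesgue_on {0..T}) (lor_speed A \<gamma>)"
  unfolding lor_length_def lor_speed_def[abs_def] ..

lemma causal_curve_endpoint:
  assumes \<gamma>: "future_causal_curve A \<gamma> T" "\<gamma> 0 = aff_id"
  shows "1 \<le> null_p A (\<gamma> T)" "-1 \<le> null_q A (\<gamma> T)"
proof -
  have T: "0 \<le> T" using \<gamma>(1) by (simp add: future_causal_curve_def)
  note nc = causal_curve_null_coords[OF \<gamma>(1)]
  obtain L where L: "L-lipschitz_on {0..T} (\<lambda>t. null_p A (\<gamma> t))" using nc(1) by blast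
  have "null_p A (\<gamma> 0) \<le> null_p A (\<gamma> T)"
    by (rule lipschitz_nondecreasing[OF L T]) (use nc(4) in \<open>auto elim!: eventually_mono\<close>)
  then show "1 \<le> null_p A (\<gamma> T)" by (simp add: \<gamma>(2))
  obtain L where L: "L-lipschitz_on {0..T} (\<lambda>t. null_q A (\<gamma> t))" using nc(2) by blast
  have "null_q A (\<gamma> 0) \<le> null_q A (\<gamma> T)"
    by (rule lipschitz_nondecreasing[OF L T]) (use nc(4) in \<open>auto elim!: eventually_mono\<close>)
  then show "-1 \<le> null_q A (\<gamma> T)" by (simp add: \<gamma>(2))
qed

lemma lor_length_le:
  assumes \<gamma>: "future_causal_curve A \<gamma> T" "\<gamma> 0 = aff_id" and "null_q A (\<gamma> T) \<le> 1"
  shows "lor_length A \<gamma> T \<le> null_dist (null_p A (\<gamma> T)) (null_q A (\<gamma> T)) / Delta A"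
proof -
  have T: "0 \<le> T" using \<gamma>(1) by (simp add: future_causal_curve_def)
  note nc = causal_curve_null_coords[OF \<gamma>(1)]
  obtain Lp Lq where lip: "Lp-lipschitz_on {0..T} (\<lambda>t. null_p A (\<gamma> t))"
    "Lq-lipschitz_on {0..T} (\<lambda>t. null_q A (\<gamma> t))" using nc(1,2) by blast
  have "integral\<^sup>L (lebesgue_on {0..T}) (\<lambda>t. Delta A * lor_speed A \<gamma> t)
      \<le> null_dist (null_p A (\<gamma> T)) (null_q A (\<gamma> T))"
    by (rule null_dist_length_bound[OF T lip _ _ _ nc(3,4)]) (use assms in simp_all)
  then show ?thesis
    using Delta_pos by (simp add: lor_length_eq_integral_speed pos_le_divide_eq mult.commute)
qed

end

section \<open>Realizing lengths by curves\<close>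

text \<open>The length is a Henstock-Kurzweil integral and the exceptional set is finite, so that curves can be
  concatenated by the rules for integrals over adjacent intervals; \<open>realizes_imp_causal_length\<close> returns to the
  Lebesgue integral.\<close>

definition realizes :: "real^2^2 \<Rightarrow> real \<times> real \<Rightarrow> real \<times> real \<Rightarrow> real \<Rightarrow> bool" where
  "realizes A z0 z1 l \<longleftrightarrow> (\<exists>\<gamma> T S. T > 0 \<and> \<gamma> 0 = z0 \<and> \<gamma> T = z1 \<and> \<gamma> ` {0..T} \<subseteq> Aff
     \<and> (\<exists>C. C-lipschitz_on {0..T} \<gamma>) \<and> finite S
     \<and> (\<forall>t\<in>{0..T} - S. \<gamma> differentiable (at t)
          \<and> future_causal A (frame_coords (\<gamma> t) (vector_derivative \<gamma> (at t))))
     \<and> (lor_speed A \<gamma> has_integral l) {0..T})"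

lemma vector_derivative_cong_open:
  fixes f g :: "real \<Rightarrow> real \<times> real"
  assumes "open X" "t \<in> X" "\<And>s. s \<in> X \<Longrightarrow> f s = g s"
  shows "vector_derivative f (at t) = vector_derivative g (at t)"
    and "f differentiable (at t) \<longleftrightarrow> g differentiable (at t)"
proof -
  have ev: "\<forall>\<^sub>F s in nhds t. f s = g s"
    using assms by (auto simp: eventually_nhds)
  then show "vector_derivative f (at t) = vector_derivative g (at t)"
    by (intro vector_derivative_cong_eq) auto
  show "f differentiable (at t) \<longleftrightarrow> g differentiable (at t)"
    using has_vector_derivative_cong_ev[of UNIV f g t] ev assms(2,3)
    by (metis (mono_tags, lifting) differentiableI_vector eventually_mono vector_derivative_works)
qed

lemma vector_derivative_shift:
  fixes f :: "real \<Rightarrow> real \<times> real"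
  shows "vector_derivative (\<lambda>s. f (s - c)) (at t) = vector_derivative f (at (t - c))"
    and "(\<lambda>s. f (s - c)) differentiable (at t) \<longleftrightarrow> f differentiable (at (t - c))"
proof -
  have *: "((\<lambda>s. g (s - c)) has_vector_derivative D) (at t)"
    if "(g has_vector_derivative D) (at (t - c))" for g :: "real \<Rightarrow> real \<times> real" and D c t
  proof -
    have "(g \<circ> (\<lambda>s. s - c) has_vector_derivative 1 *\<^sub>R D) (at t)"
      by (rule vector_diff_chain_at) (use that in \<open>auto intro!: derivative_eq_intros\<close>)
    then show ?thesis by (simp add: o_def)
  qed
  have iff: "((\<lambda>s. f (s - c)) has_vector_derivative D) (at t)
      \<longleftrightarrow> (f has_vector_derivative D) (at (t - c))" for D
    using *[of f D t c] *[of "\<lambda>s. f (s - c)" D "t - c" "-c"] by auto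
  show "vector_derivative (\<lambda>s. f (s - c)) (at t) = vector_derivative f (at (t - c))"
    by (simp add: vector_derivative_def iff)
  show "(\<lambda>s. f (s - c)) differentiable (at t) \<longleftrightarrow> f differentiable (at (t - c))"
    using iff by (metis differentiableI_vector vector_derivative_works)
qed

lemma has_integral_shift_interval:
  fixes f :: "real \<Rightarrow> real"
  assumes "(f has_integral l) {0..b}"
  shows "((\<lambda>t. f (t - c)) has_integral l) {c..c + b}"
proof -
  have "(\<lambda>x. x + c) ` {0..b} = {c..c + b}"
    by (auto simp: image_iff intro: bexI[of _ "_ - c"])
  then show ?thesis
    using has_integral_affinity[of f l 0 b 1 "-c"] assms by (simp add: add.commute)
qed

lemma realizes_trans:
  assumes "realizes A z0 z1 l" "realizes A z1 z2 m"
  shows "realizes A z0 z2 (l + m)"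
proof -
  obtain \<gamma> T S C where 1: "T > 0" "\<gamma> 0 = z0" "\<gamma> T = z1" "\<And>t. t \<in> {0..T} \<Longrightarrow> \<gamma> t \<in> Aff"
    "C-lipschitz_on {0..T} \<gamma>" "finite S"
    "\<And>t. t \<in> {0..T} - S \<Longrightarrow> \<gamma> differentiable (at t)
          \<and> future_causal A (frame_coords (\<gamma> t) (vector_derivative \<gamma> (at t)))"
    "(lor_speed A \<gamma> has_integral l) {0..T}"
    using assms(1) unfolding realizes_def by (auto simp: image_subset_iff)
  obtain \<beta> U R D where 2: "U > 0" "\<beta> 0 = z1" "\<beta> U = z2" "\<And>t. t \<in> {0..U} \<Longrightarrow> \<beta> t \<in> Aff"
    "D-lipschitz_on {0..U} \<beta>" "finite R"
    "\<And>t. t \<in> {0..U} - R \<Longrightarrow> \<beta> differentiable (at t)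
          \<and> future_causal A (frame_coords (\<beta> t) (vector_derivative \<beta> (at t)))"
    "(lor_speed A \<beta> has_integral m) {0..U}"
    using assms(2) unfolding realizes_def by (auto simp: image_subset_iff)
  define \<eta> where "\<eta> t = (if t \<le> T then \<gamma> t else \<beta> (t - T))" for t
  \<comment> \<open>At \<open>T\<close> the concatenation may have a corner.\<close>
  define Q where "Q = insert T (S \<union> (\<lambda>t. t + T) ` R)"
  have left: "vector_derivative \<eta> (at t) = vector_derivative \<gamma> (at t)"
    "\<eta> differentiable (at t) \<longleftrightarrow> \<gamma> differentiable (at t)" if "t < T" for t
    using vector_derivative_cong_open[of "{..<T}" t \<eta> \<gamma>] that by (auto simp: \<eta>_def)
  have right: "vector_derivative \<eta> (at t) = vector_derivative \<beta> (at (t - T))"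
    "\<eta> differentiable (at t) \<longleftrightarrow> \<beta> differentiable (at (t - T))" if "T < t" for t
    using vector_derivative_cong_open[of "{T<..}" t \<eta> "\<lambda>s. \<beta> (s - T)"] that
    by (auto simp: \<eta>_def vector_derivative_shift)
  have "(max C D)-lipschitz_on {0..T} \<gamma>"
    using 1(5) by (rule lipschitz_on_mono) auto
  moreover have "(max C D)-lipschitz_on {T..T + U} (\<lambda>t. \<beta> (t - T))"
  proof (rule lipschitz_on_mono)
    have "1-lipschitz_on {T..T + U} (\<lambda>t. t - T)"
      by (auto intro!: lipschitz_onI simp: dist_real_def)
    moreover have "(\<lambda>t. t - T) ` {T..T + U} = {0..U}"
      by (auto simp: image_iff intro: bexI[of _ "_ + T"])
    ultimately show "(D * 1)-lipschitz_on {T..T + U} (\<lambda>t. \<beta> (t - T))"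
      using 2(5) by (intro lipschitz_on_compose2) auto
  qed auto
  ultimately have lip: "(max C D)-lipschitz_on {0..T + U} \<eta>"
    unfolding \<eta>_def using lipschitz_on_concat[of "max C D" 0 T \<gamma> "T + U" "\<lambda>t. \<beta> (t - T)"] 1(3) 2(2)
    by simp
  have "(lor_speed A \<eta> has_integral l) {0..T}"
    using has_integral_spike_finite[OF _ _ 1(8), of "{T}" "lor_speed A \<eta>"] left
    by (auto simp: lor_speed_def \<eta>_def)
  moreover have "(lor_speed A \<eta> has_integral m) {T..T + U}"
    using has_integral_spike_finite[OF _ _ has_integral_shift_interval[OF 2(8), of T], of "{T}" "lor_speed A \<eta>"] right
    by (auto simp: lor_speed_def \<eta>_def)
  ultimately have int: "(lor_speed A \<eta> has_integral (l + m)) {0..T + U}"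
    using 1(1) 2(1) by (intro has_integral_combine[of 0 T]) auto
  have der: "\<eta> differentiable (at t) \<and> future_causal A (frame_coords (\<eta> t) (vector_derivative \<eta> (at t)))"
    if t: "t \<in> {0..T + U} - Q" for t
  proof (cases "t < T")
    case True
    then show ?thesis using 1(7)[of t] t left[OF True] by (auto simp: \<eta>_def Q_def)
  next
    case False
    then have "T < t" using t by (auto simp: Q_def)
    moreover have "t - T \<in> {0..U} - R" using t False by (force simp: Q_def)
    ultimately show ?thesis using 2(7)[of "t - T"] right[of t] by (auto simp: \<eta>_def)
  qed
  show ?thesis
    unfolding realizes_def
  proof (rule exI[of _ \<eta>], rule exI[of _ "T + U"], rule exI[of _ Q], intro conjI ballI)
    show "\<eta> ` {0..T + U} \<subseteq> Aff" using 1(4) 2(4) by (auto simp: \<eta>_def)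
    show "\<exists>C. C-lipschitz_on {0..T + U} \<eta>" using lip by blast
    show "\<eta> differentiable (at t)" "future_causal A (frame_coords (\<eta> t) (vector_derivative \<eta> (at t)))"
      if "t \<in> {0..T + U} - Q" for t using der[OF that] by auto
    show "\<eta> (T + U) = z2" using 2(1,3) by (simp add: \<eta>_def)
  qed (use 1(1,2,6) 2(1,6) int in \<open>auto simp: \<eta>_def Q_def\<close>)
qed

context negatively_curved
begin

text \<open>The speed is nonnegative off the finite exceptional set, and for nonnegative functions the
  Henstock-Kurzweil and the Lebesgue integral agree.\<close>

lemma realizes_imp_causal_length:
  assumes "realizes A z0 z1 l"
  shows "l \<in> causal_lengths A z0 z1"
proof -
  obtain \<gamma> T S where \<gamma>: "T > 0" "\<gamma> 0 = z0" "\<gamma> T = z1" "\<gamma> ` {0..T} \<subseteq> Aff"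
    "\<exists>C. C-lipschitz_on {0..T} \<gamma>" "finite S"
    "\<And>t. t \<in> {0..T} - S \<Longrightarrow> \<gamma> differentiable (at t)
          \<and> future_causal A (frame_coords (\<gamma> t) (vector_derivative \<gamma> (at t)))"
    and l: "(lor_speed A \<gamma> has_integral l) {0..T}"
    using assms unfolding realizes_def by blast
  have S: "negligible S" using \<gamma>(6) by (rule negligible_finite)
  then have "AE t in lebesgue. t \<notin> S"
    by (simp add: negligible_iff_null_sets AE_not_in)
  then have "AE t in lebesgue_on {0..T}. t \<in> {0..T} - S"
    by (auto simp: AE_restrict_space_iff elim!: eventually_mono)
  from eventually_mono[OF this \<gamma>(7)] have fc: "future_causal_curve A \<gamma> T"
    unfolding future_causal_curve_def using \<gamma>(1,4,5) by simp
  have nonneg: "0 \<le> lor_speed A \<gamma> t" if t: "t \<in> {0..T} - S" for t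
  proof -
    have "\<bar>(A *v frame_coords (\<gamma> t) (vector_derivative \<gamma> (at t)))$2\<bar>
        \<le> \<bar>(A *v frame_coords (\<gamma> t) (vector_derivative \<gamma> (at t)))$1\<bar>"
      using \<gamma>(7)[OF t] by (auto simp: future_causal_def)
    then show ?thesis by (simp add: lor_speed_def Let_def abs_le_square_iff)
  qed
  define f where "f t = (if t \<in> S then 0 else lor_speed A \<gamma> t)" for t
  have "(f has_integral l) {0..T}"
    by (rule has_integral_spike[OF S _ l]) (simp add: f_def)
  then have "f absolutely_integrable_on {0..T}"
    using nonneg by (intro nonnegative_absolutely_integrable_1) (auto simp: f_def)
  then have "lor_speed A \<gamma> absolutely_integrable_on {0..T}"
    by (rule absolutely_integrable_spike[OF _ S]) (simp add: f_def)
  then have "integrable (lebesgue_on {0..T}) (lor_speed A \<gamma>)"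
    by (simp add: set_integrable_def integrable_restrict_space)
  then have "lor_length A \<gamma> T = integral {0..T} (lor_speed A \<gamma>)"
    unfolding lor_length_eq_integral_speed by (rule lebesgue_integral_eq_integral) auto
  then have "l = lor_length A \<gamma> T" using integral_unique[OF l] by simp
  then show ?thesis
    using fc \<gamma>(2,3) unfolding causal_lengths_def by blast
qed

text \<open>The inverse of the null coordinates.\<close>

definition null_point :: "real \<Rightarrow> real \<Rightarrow> real \<times> real" where
  "null_point p q = ((lam A + nu A) / 2 * p + (lam A - nu A) / 2 * q - nu A, p / 2 - q / 2)"

lemma lam_pos: "0 < lam A"
  using entry_signs det_pos by (simp add: lam_eq)

lemma time_eq_null_mean: "(fst z - nu A * (snd z - 1)) / lam A = (null_p A z + null_q A z) / 2"
proof -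
  define m where "m = (A$1$1 - A$2$1) * (A$1$1 + A$2$1)"
  have m: "0 < m" using entry_signs by (simp add: m_def)
  have "null_p A z + null_q A z = ((A$1$1 - A$2$1) * lambda2 A z - (A$1$1 + A$2$1) * lambda1 A z) / det A"
    by (simp add: null_p_def null_q_def diff_divide_distrib)
  also have "(A$1$1 - A$2$1) * lambda2 A z - (A$1$1 + A$2$1) * lambda1 A z
      = 2 * (m * fst z - (A$2$1 * A$2$2 - A$1$1 * A$1$2) * (snd z - 1))"
    by (simp add: lambda1_def lambda2_def m_def algebra_simps)
  also have "\<dots> = 2 * m * (fst z - nu A * (snd z - 1))"
    using m by (simp add: nu_eq m_def[symmetric] field_simps)
  finally show ?thesis using m det_pos by (simp add: lam_eq m_def[symmetric])
qed

lemma null_point_null [simp]: "null_point (null_p A z) (null_q A z) = z"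
proof -
  have "fst z = lam A * ((null_p A z + null_q A z) / 2) + nu A * (snd z - 1)"
    using lam_pos by (simp add: time_eq_null_mean[symmetric])
  moreover have "snd z = (null_p A z - null_q A z) / 2" by (simp add: null_p_minus_q)
  ultimately show ?thesis
    by (auto simp: null_point_def prod_eq_iff field_simps)
qed

lemma null_p_point [simp]: "null_p A (null_point p q) = p"
  and null_q_point [simp]: "null_q A (null_point p q) = q"
proof -
  have s: "null_p A (null_point p q) + null_q A (null_point p q) = p + q"
  proof -
    have "fst (null_point p q) - nu A * (snd (null_point p q) - 1) = lam A * ((p + q) / 2)"
      by (simp add: null_point_def field_simps)
    then show ?thesis
      using time_eq_null_mean[of "null_point p q"] lam_pos by simp
  qed
  have d: "null_p A (null_point p q) - null_q A (null_point p q) = p - q"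
    by (simp add: null_p_minus_q) (simp add: null_point_def)
  show "null_p A (null_point p q) = p" "null_q A (null_point p q) = q"
    using s d by linarith+
qed

lemma null_point_Aff [simp]: "null_point p q \<in> Aff \<longleftrightarrow> q < p"
  by (simp add: null_point_def Aff_def)

lemma null_point_start: "null_point 1 (-1) = aff_id"
  using null_point_null[of aff_id] by simp

lemma realizes_smooth:
  fixes p q p' q' \<Theta> :: "real \<Rightarrow> real"
  assumes T: "0 < T"
    and p: "\<And>t. t \<in> {0..T} \<Longrightarrow> (p has_real_derivative p' t) (at t)"
    and q: "\<And>t. t \<in> {0..T} \<Longrightarrow> (q has_real_derivative q' t) (at t)"
    and bnd: "\<And>t. t \<in> {0..T} \<Longrightarrow> 0 \<le> p' t \<and> p' t \<le> C \<and> 0 \<le> q' t \<and> q' t \<le> C"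
    and pq: "\<And>t. t \<in> {0..T} \<Longrightarrow> q t < p t"
    and \<Theta>: "\<And>t. t \<in> {0..T} \<Longrightarrow>
      (\<Theta> has_real_derivative 2 * sqrt (p' t * q' t) / (p t - q t)) (at t)"
  shows "realizes A (null_point (p 0) (q 0)) (null_point (p T) (q T)) ((\<Theta> T - \<Theta> 0) / Delta A)"
proof -
  define \<gamma> where "\<gamma> t = null_point (p t) (q t)" for t
  have "0 \<le> C" using bnd[of 0] T by auto
  then have lp: "C-lipschitz_on {0..T} p" and lq: "C-lipschitz_on {0..T} q"
    using lipschitz_on_bounded_derivative[of "{0..T}" C p p'] p
      lipschitz_on_bounded_derivative[of "{0..T}" C q q'] q bnd by force+
  have \<gamma>_eq: "\<gamma> = (\<lambda>t. ((lam A + nu A) / 2 * p t + (lam A - nu A) / 2 * q t - nu A, 1 / 2 * p t - 1 / 2 * q t))"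
    by (simp add: fun_eq_iff \<gamma>_def null_point_def)
  have "\<exists>L. L-lipschitz_on {0..T} \<gamma>"
    unfolding \<gamma>_eq
    using lipschitz_on_Pair[OF
        lipschitz_on_diff[OF lipschitz_on_add[OF lipschitz_on_cmult_real[OF lp] lipschitz_on_cmult_real[OF lq]]
          lipschitz_on_constant]
        lipschitz_on_diff[OF lipschitz_on_cmult_real[OF lp] lipschitz_on_cmult_real[OF lq]]]
    by blast
  moreover have D: "\<gamma> differentiable (at t)" "null_dp A (vector_derivative \<gamma> (at t)) = p' t"
    "null_dq A (vector_derivative \<gamma> (at t)) = q' t" if t: "t \<in> {0..T}" for t
  proof -
    have "((\<lambda>t. (lam A + nu A) / 2 * p t + (lam A - nu A) / 2 * q t - nu A) has_real_derivative
        (lam A + nu A) / 2 * p' t + (lam A - nu A) / 2 * q' t) (at t)"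
      "((\<lambda>t. p t / 2 - q t / 2) has_real_derivative p' t / 2 - q' t / 2) (at t)"
      using p[OF t] q[OF t] by (auto intro!: derivative_eq_intros simp: mult.commute)
    then have "(\<gamma> has_vector_derivative ((lam A + nu A) / 2 * p' t + (lam A - nu A) / 2 * q' t,
        p' t / 2 - q' t / 2)) (at t)"
      unfolding \<gamma>_def[abs_def] null_point_def has_real_derivative_iff_has_vector_derivative
      by (rule has_vector_derivative_Pair)
    then show d: "\<gamma> differentiable (at t)" by (rule differentiableI_vector)
    then have "(\<gamma> has_vector_derivative vector_derivative \<gamma> (at t)) (at t)"
      by (simp add: vector_derivative_works)
    from null_p_has_derivative[OF this] p[OF t] q[OF t]
    show "null_dp A (vector_derivative \<gamma> (at t)) = p' t"
      "null_dq A (vector_derivative \<gamma> (at t)) = q' t"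
      by (auto simp: \<gamma>_def intro: DERIV_unique)
  qed
  moreover have Aff: "\<gamma> t \<in> Aff" if "t \<in> {0..T}" for t
    using pq[OF that] by (simp add: \<gamma>_def)
  moreover have "future_causal A (frame_coords (\<gamma> t) (vector_derivative \<gamma> (at t)))" if "t \<in> {0..T}" for t
    using future_causal_iff[OF Aff[OF that]] D[OF that] bnd[OF that] by simp
  moreover have "(lor_speed A \<gamma> has_integral ((\<Theta> T - \<Theta> 0) / Delta A)) {0..T}"
  proof -
    have "((\<lambda>t. 2 * sqrt (p' t * q' t) / (p t - q t)) has_integral (\<Theta> T - \<Theta> 0)) {0..T}"
      using T \<Theta> by (intro fundamental_theorem_of_calculus)
        (auto simp: has_real_derivative_iff_has_vector_derivative[symmetric] intro: DERIV_subset)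
    then have "((\<lambda>t. 2 * sqrt (p' t * q' t) / (p t - q t) / Delta A) has_integral
        (\<Theta> T - \<Theta> 0) / Delta A) {0..T}" by (rule has_integral_divide)
    then show ?thesis
      by (rule has_integral_eq[rotated])
        (simp add: lor_speed_eq[of \<gamma>] Aff D, simp add: \<gamma>_def)
  qed
  ultimately show ?thesis
    unfolding realizes_def using T
    by (intro exI[of _ \<gamma>] exI[of _ T] exI[of _ "{}"]) (auto simp: \<gamma>_def)
qed

lemma realizes_null_p:
  assumes "q < p" "p \<le> r"
  shows "realizes A (null_point p q) (null_point r q) 0"
proof -
  have "realizes A (null_point (p + 0 * (r - p)) q) (null_point (p + 1 * (r - p)) q) ((0 - 0) / Delta A)"
  proof (rule realizes_smooth[where p' = "\<lambda>_. r - p" and q' = "\<lambda>_. 0" and C = "r - p"])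
    show "q < p + t * (r - p)" if "t \<in> {0..1}" for t
    proof -
      have "0 \<le> t * (r - p)" using assms that by simp
      then show ?thesis using assms by linarith
    qed
  qed (use assms in \<open>auto intro!: derivative_eq_intros\<close>)
  then show ?thesis by simp
qed

lemma realizes_null_q:
  assumes "r < p" "q \<le> r"
  shows "realizes A (null_point p q) (null_point p r) 0"
proof -
  have "realizes A (null_point p (q + 0 * (r - q))) (null_point p (q + 1 * (r - q))) ((0 - 0) / Delta A)"
  proof (rule realizes_smooth[where p' = "\<lambda>_. 0" and q' = "\<lambda>_. r - q" and C = "r - q"])
    show "q + t * (r - q) < p" if "t \<in> {0..1}" for t
    proof -
      have "t * (r - q) \<le> r - q" using assms that by (intro mult_left_le_one_le) auto
      then show ?thesis using assms by linarith
    qed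
  qed (use assms in \<open>auto intro!: derivative_eq_intros\<close>)
  then show ?thesis by simp
qed

text \<open>A translation along \<open>p - q = e\<close> at constant speed: the closer to the boundary \<open>p = q\<close> of the group, the
  longer.\<close>

lemma realizes_near_boundary:
  assumes "0 < e" "0 \<le> s"
  shows "realizes A (null_point p (p - e)) (null_point (p + s) (p + s - e)) (2 * s / e / Delta A)"
proof -
  have "realizes A (null_point (p + 0 * s) (p - e + 0 * s)) (null_point (p + 1 * s) (p - e + 1 * s))
      ((1 * (2 * s / e) - 0 * (2 * s / e)) / Delta A)"
    by (rule realizes_smooth[where p' = "\<lambda>_. s" and q' = "\<lambda>_. s" and C = s and \<Theta> = "\<lambda>t. t * (2 * s / e)"])
      (use assms in \<open>auto intro!: derivative_eq_intros\<close>)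
  then show ?thesis by (simp add: algebra_simps)
qed

text \<open>The timelike geodesics of the model are the images of the hyperbola \<open>p q = -1\<close> under isometries, that is,
  graphs of involutive Moebius transformations \<open>q = (\<alpha> p + \<beta>) / (\<gamma> p - \<alpha>)\<close>. Passing through \<open>(1, -1)\<close> means
  \<open>\<beta> = - \<gamma>\<close>, and the end point determines the ratio \<open>\<alpha> : \<gamma>\<close>.\<close>

lemma realizes_geodesic:
  assumes "1 < p" "-1 < q" "q < 1"
  shows "realizes A aff_id (null_point p q) (null_dist p q / Delta A)"
proof -
  define \<alpha> where "\<alpha> = 1 + p * q"
  define \<gamma> where "\<gamma> = p + q"
  define \<kappa> where "\<kappa> = sqrt ((p + q)\<^sup>2 - (1 + p * q)\<^sup>2)"
  define x where "x t = \<gamma> * (1 + t) - \<alpha>" for t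
  have \<gamma>: "0 < \<gamma>" using assms by (simp add: \<gamma>_def)
  have k2: "(p + q)\<^sup>2 - (1 + p * q)\<^sup>2 = (p\<^sup>2 - 1) * (1 - q\<^sup>2)"
    by (simp add: power2_eq_square algebra_simps)
  have "0 < (p\<^sup>2 - 1) * (1 - q\<^sup>2)"
    using assms by (simp add: power2_eq_square[of p] less_1_mult abs_square_less_1)
  then have \<kappa>: "0 < \<kappa>" "\<kappa>\<^sup>2 = \<gamma>\<^sup>2 - \<alpha>\<^sup>2"
    by (simp_all add: \<kappa>_def k2 \<gamma>_def \<alpha>_def)
  have x0: "x 0 = (p - 1) * (1 - q)" by (simp add: x_def \<gamma>_def \<alpha>_def algebra_simps)
  then have x0_pos: "0 < x 0" using assms by simp
  have x: "x 0 \<le> x t" if "0 \<le> t" for t using \<gamma> that by (simp add: x_def)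
  \<comment> \<open>The curve is parametrized by \<open>p = 1 + t\<close>; \<open>x t\<close> is the denominator of the transformation.\<close>
  have gap: "(1 + t) - (\<alpha> * (1 + t) - \<gamma>) / x t = (\<kappa>\<^sup>2 + (x t)\<^sup>2) / (\<gamma> * x t)" if "0 \<le> t" for t
  proof -
    have "\<kappa>\<^sup>2 + (x t)\<^sup>2 = \<gamma> * ((1 + t) * x t - (\<alpha> * (1 + t) - \<gamma>))"
      unfolding \<kappa>(2) x_def by (simp add: power2_eq_square algebra_simps)
    moreover have "0 < x t" using x[OF that] x0_pos by linarith
    ultimately show ?thesis using \<gamma> by (simp add: diff_divide_eq_iff)
  qed
  have sq: "0 < \<kappa>\<^sup>2 + (x t)\<^sup>2" for t using \<kappa>(1) by (simp add: add_pos_nonneg)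
  have "realizes A (null_point (1 + 0) ((\<alpha> * (1 + 0) - \<gamma>) / x 0))
      (null_point (1 + (p - 1)) ((\<alpha> * (1 + (p - 1)) - \<gamma>) / x (p - 1)))
      ((2 * arctan (x (p - 1) / \<kappa>) - 2 * arctan (x 0 / \<kappa>)) / Delta A)"
  proof (rule realizes_smooth[where p' = "\<lambda>_. 1" and q' = "\<lambda>t. \<kappa>\<^sup>2 / (x t)\<^sup>2" and C = "1 + \<kappa>\<^sup>2 / (x 0)\<^sup>2"])
    fix t assume "t \<in> {0..p - 1}"
    then have t: "0 \<le> t" by simp
    then have xt: "0 < x t" using x x0_pos by force
    have dx: "(x has_real_derivative \<gamma>) (at t)"
      unfolding x_def[abs_def] by (auto intro!: derivative_eq_intros)
    have num: "\<alpha> * x t - (\<alpha> * (1 + t) - \<gamma>) * \<gamma> = \<kappa>\<^sup>2"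
      unfolding \<kappa>(2) x_def by (simp add: power2_eq_square algebra_simps)
    have "((\<lambda>t. (\<alpha> * (1 + t) - \<gamma>) / x t) has_real_derivative
        (\<alpha> * x t - (\<alpha> * (1 + t) - \<gamma>) * \<gamma>) / (x t * x t)) (at t)"
      using xt by (intro DERIV_divide dx) (auto intro!: derivative_eq_intros)
    then show "((\<lambda>t. (\<alpha> * (1 + t) - \<gamma>) / x t) has_real_derivative \<kappa>\<^sup>2 / (x t)\<^sup>2) (at t)"
      by (simp add: num power2_eq_square)
    have "(x 0)\<^sup>2 \<le> (x t)\<^sup>2" using x[OF t] x0_pos by (intro power_mono) auto
    then show "0 \<le> (1::real) \<and> 1 \<le> 1 + \<kappa>\<^sup>2 / (x 0)\<^sup>2 \<and> 0 \<le> \<kappa>\<^sup>2 / (x t)\<^sup>2 \<and> \<kappa>\<^sup>2 / (x t)\<^sup>2 \<le> 1 + \<kappa>\<^sup>2 / (x 0)\<^sup>2"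
      using x0_pos by (auto intro!: add_increasing frac_le)
    have "0 < (\<kappa>\<^sup>2 + (x t)\<^sup>2) / (\<gamma> * x t)" using sq \<gamma> xt by simp
    then show "(\<alpha> * (1 + t) - \<gamma>) / x t < 1 + t" using gap[OF t] by linarith
    have speed: "2 * sqrt (1 * (\<kappa>\<^sup>2 / (x t)\<^sup>2)) / (1 + t - (\<alpha> * (1 + t) - \<gamma>) / x t) = 2 * (\<gamma> * \<kappa> / (\<kappa>\<^sup>2 + (x t)\<^sup>2))"
      unfolding gap[OF t] using \<kappa>(1) xt \<gamma> by (simp add: real_sqrt_divide)
    have der: "((\<lambda>t. 2 * arctan (x t / \<kappa>)) has_real_derivative
        2 * (inverse (1 + (x t / \<kappa>)\<^sup>2) * (\<gamma> / \<kappa>))) (at t)"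
      by (intro DERIV_cmult DERIV_chain2[OF DERIV_arctan] DERIV_cdivide dx)
    have slope: "inverse (1 + (x t / \<kappa>)\<^sup>2) * (\<gamma> / \<kappa>) = \<gamma> * \<kappa> / (\<kappa>\<^sup>2 + (x t)\<^sup>2)"
    proof -
      have "1 + (x t / \<kappa>)\<^sup>2 = (\<kappa>\<^sup>2 + (x t)\<^sup>2) / \<kappa>\<^sup>2" using \<kappa>(1) by (simp add: power_divide field_simps)
      then show ?thesis using \<kappa>(1) by (simp add: power2_eq_square)
    qed
    show "((\<lambda>t. 2 * arctan (x t / \<kappa>)) has_real_derivative
        2 * sqrt (1 * (\<kappa>\<^sup>2 / (x t)\<^sup>2)) / (1 + t - (\<alpha> * (1 + t) - \<gamma>) / x t)) (at t)"
      using der unfolding speed slope .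
  qed (use assms in \<open>auto intro!: derivative_eq_intros\<close>)
  moreover have "2 * arctan (x (p - 1) / \<kappa>) - 2 * arctan (x 0 / \<kappa>) = null_dist p q"
    using geodesic_arctan_difference[OF assms] by (simp add: x_def \<gamma>_def \<alpha>_def \<kappa>_def)
  moreover have "(\<alpha> * (1 + 0) - \<gamma>) / x 0 = -1"
    using x0_pos by (simp add: x_def divide_eq_eq)
  moreover have "(\<alpha> * (1 + (p - 1)) - \<gamma>) / x (p - 1) = q"
  proof -
    have "x (p - 1) \<noteq> 0" using x[of "p - 1"] x0_pos assms(1) by simp
    moreover have "\<alpha> * (1 + (p - 1)) - \<gamma> = q * x (p - 1)"
      by (simp add: x_def \<gamma>_def \<alpha>_def algebra_simps)
    ultimately show ?thesis by simp
  qed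
  ultimately show ?thesis by (simp add: null_point_start)
qed

end

section \<open>The distance\<close>

context negatively_curved
begin

lemma lambda1_le_iff: "lambda1 A z \<le> 0 \<longleftrightarrow> -1 \<le> null_q A z"
  and lambda2_ge_iff: "0 \<le> lambda2 A z \<longleftrightarrow> 1 \<le> null_p A z"
  using entry_signs det_pos
  by (auto simp: null_q_def null_p_def divide_le_0_iff mult_le_0_iff zero_le_divide_iff zero_le_mult_iff)

text \<open>The point \<open>B\<close> lies on the boundary line \<open>y = 0\<close> and on the zero set of \<open>lambda2\<close>, that is, at
  \<open>p = q = 1\<close>. So the zero set of \<open>lambda3\<close>, the parallel through \<open>B\<close> to the zero set of \<open>lambda1\<close>, is
  the line \<open>q = 1\<close>.\<close>

lemma null_q_eq_lambda3: "null_q A z = 1 - (A$1$1 + A$2$1) * lambda3 A z / det A"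
proof -
  have "(A$1$1 + A$2$1) * lambda3 A z = (A$1$1 + A$2$1) * lambda1 A z
      - ((A$2$1 - A$1$1) * (A$2$2 + A$1$2) - (A$1$1 + A$2$1) * (A$2$2 - A$1$2))"
    using entry_signs by (simp add: lambda3_def lambda1_def point_B_def field_simps)
  also have "\<dots> = (A$1$1 + A$2$1) * lambda1 A z + 2 * det A"
    by (simp add: det_2 algebra_simps)
  finally have "(A$1$1 + A$2$1) * lambda3 A z = (A$1$1 + A$2$1) * lambda1 A z + 2 * det A" .
  then show ?thesis using det_pos by (simp add: null_q_def add_divide_distrib)
qed

lemma lambda3_pos_iff: "0 < lambda3 A z \<longleftrightarrow> null_q A z < 1"
  and lambda3_neg_iff: "lambda3 A z < 0 \<longleftrightarrow> 1 < null_q A z"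
  and lambda3_eq_iff: "lambda3 A z = 0 \<longleftrightarrow> null_q A z = 1"
  using entry_signs det_pos
  by (auto simp: null_q_eq_lambda3 zero_less_divide_iff divide_less_0_iff zero_less_mult_iff mult_less_0_iff)

lemma Aff_iff: "z \<in> Aff \<longleftrightarrow> null_q A z < null_p A z"
  using null_p_minus_q[of z] by (auto simp: Aff_def)

lemma realizes_null:
  assumes "z \<in> Aff" "1 \<le> null_p A z" "-1 \<le> null_q A z"
  shows "realizes A aff_id z 0"
proof -
  have "realizes A (null_point 1 (-1)) (null_point (null_p A z) (-1)) 0"
    using assms by (intro realizes_null_p) auto
  moreover have "realizes A (null_point (null_p A z) (-1)) (null_point (null_p A z) (null_q A z)) 0"
    using assms by (intro realizes_null_q) (auto simp: Aff_iff)
  ultimately show ?thesis using realizes_trans by (fastforce simp: null_point_start)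
qed

text \<open>Along a causal curve both null coordinates are nondecreasing; conversely, one can increase \<open>p\<close> first and
  then \<open>q\<close>, without leaving the group.\<close>

lemma J_plus_iff: "z \<in> J_plus A \<longleftrightarrow> z \<in> Aff \<and> 1 \<le> null_p A z \<and> -1 \<le> null_q A z"
proof
  assume "z \<in> J_plus A"
  then obtain \<gamma> T where \<gamma>: "future_causal_curve A \<gamma> T" "\<gamma> 0 = aff_id" "\<gamma> T = z"
    by (auto simp: J_plus_def)
  then have "z \<in> Aff" by (auto simp: future_causal_curve_def)
  then show "z \<in> Aff \<and> 1 \<le> null_p A z \<and> -1 \<le> null_q A z"
    using causal_curve_endpoint[OF \<gamma>(1,2)] \<gamma>(3) by simp
next
  assume "z \<in> Aff \<and> 1 \<le> null_p A z \<and> -1 \<le> null_q A z"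
  then have "0 \<in> causal_lengths A aff_id z"
    by (intro realizes_imp_causal_length realizes_null) auto
  then show "z \<in> J_plus A" by (auto simp: causal_lengths_def J_plus_def)
qed

lemma lor_dist_outside: "z \<notin> J_plus A \<Longrightarrow> lor_dist A aff_id z = 0"
  by (auto simp: lor_dist_def causal_lengths_def J_plus_def)

lemma lor_dist_ge:
  assumes "realizes A z0 z l"
  shows "ereal l \<le> lor_dist A z0 z"
  using realizes_imp_causal_length[OF assms] by (auto simp: lor_dist_def intro: SUP_upper)

lemma lor_dist_le:
  assumes "z \<in> J_plus A" "null_q A z \<le> 1"
  shows "lor_dist A aff_id z \<le> ereal (null_dist (null_p A z) (null_q A z) / Delta A)"
proof -
  have "causal_lengths A aff_id z \<noteq> {}"
    using assms(1) by (auto simp: causal_lengths_def J_plus_def)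
  moreover have "l \<le> null_dist (null_p A z) (null_q A z) / Delta A"
    if "l \<in> causal_lengths A aff_id z" for l
    using that assms(2) lor_length_le by (auto simp: causal_lengths_def)
  ultimately show ?thesis by (auto simp: lor_dist_def intro!: SUP_least)
qed

text \<open>On the lines \<open>p = 1\<close> and \<open>q = -1\<close> the upper bound \<open>null_dist\<close> is \<open>arccos 1\<close>.\<close>

lemma lor_dist_light_cone:
  assumes "z \<in> J_plus A" "null_p A z = 1 \<or> null_q A z = -1"
  shows "lor_dist A aff_id z = 0"
proof -
  have z: "null_q A z < null_p A z" "1 \<le> null_p A z" "-1 \<le> null_q A z"
    using assms(1) by (auto simp: J_plus_iff Aff_iff)
  have "null_dist (null_p A z) (null_q A z) = 0"
    using assms(2) z by (auto simp: null_dist_def add.commute)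
  moreover have "null_q A z \<le> 1" using assms(2) z by auto
  ultimately have "lor_dist A aff_id z \<le> 0" using lor_dist_le[OF assms(1)] by (simp add: zero_ereal_def)
  moreover have "ereal 0 \<le> lor_dist A aff_id z"
    using z assms(1) by (intro lor_dist_ge realizes_null) (auto simp: J_plus_iff)
  ultimately show ?thesis by (simp add: zero_ereal_def)
qed

lemma lor_dist_geodesic:
  assumes "1 < null_p A z" "-1 < null_q A z" "null_q A z < 1"
  shows "lor_dist A aff_id z = ereal (null_dist (null_p A z) (null_q A z) / Delta A)"
proof (rule antisym)
  show "lor_dist A aff_id z \<le> ereal (null_dist (null_p A z) (null_q A z) / Delta A)"
    using assms by (intro lor_dist_le) (auto simp: J_plus_iff Aff_iff)
  show "ereal (null_dist (null_p A z) (null_q A z) / Delta A) \<le> lor_dist A aff_id z"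
    using lor_dist_ge[OF realizes_geodesic[OF assms]] by simp
qed

text \<open>At \<open>q = 1\<close> the upper bound is \<open>arccos (-1)\<close>. It is approached by geodesics to \<open>(p, q)\<close> with \<open>q < 1\<close>
  close to \<open>1\<close>, continued by a null segment.\<close>

lemma lor_dist_F:
  assumes "z \<in> Aff" "null_q A z = 1"
  shows "lor_dist A aff_id z = ereal (pi / Delta A)"
proof (rule antisym)
  define p where "p = null_p A z"
  have p: "1 < p" using assms by (simp add: Aff_iff p_def)
  have z: "z = null_point p 1" using null_point_null[of z] assms(2) by (simp add: p_def)
  have arg: "(1 - p * 1) / (p - 1) = -1" using p by (simp add: divide_eq_eq)
  then have "null_dist p 1 = pi" by (simp add: null_dist_def)
  then show "lor_dist A aff_id z \<le> ereal (pi / Delta A)"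
    using lor_dist_le[of z] assms p by (simp add: J_plus_iff p_def)
  have ge: "ereal (null_dist p q / Delta A) \<le> lor_dist A aff_id z" if "0 < q" "q < 1" for q
  proof -
    have "realizes A aff_id (null_point p q) (null_dist p q / Delta A)"
      using p that by (intro realizes_geodesic) auto
    moreover have "realizes A (null_point p q) (null_point p 1) 0"
      using p that by (intro realizes_null_q) auto
    ultimately show ?thesis unfolding z using lor_dist_ge realizes_trans by fastforce
  qed
  have ev: "\<forall>\<^sub>F q::real in at_left 1. 0 < q \<and> q < 1"
    by (rule eventually_at_leftI[of 0]) auto
  have lim: "((\<lambda>q. (1 - p * q) / (p - q)) \<longlongrightarrow> (1 - p * 1) / (p - 1)) (at_left 1)"
    using p by (intro tendsto_intros) auto
  have "((\<lambda>q. arccos ((1 - p * q) / (p - q))) \<longlongrightarrow> arccos ((1 - p * 1) / (p - 1))) (at_left 1)"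
    by (rule continuous_on_tendsto_compose[OF continuous_on_arccos' lim])
      (use ev p null_dist_arg_bounds[of p] arg in \<open>auto elim!: eventually_mono\<close>)
  then have "((\<lambda>q. null_dist p q / Delta A) \<longlongrightarrow> pi / Delta A) (at_left 1)"
    unfolding arg null_dist_def using Delta_pos by (intro tendsto_intros) auto
  then have "((\<lambda>q. ereal (null_dist p q / Delta A)) \<longlongrightarrow> ereal (pi / Delta A)) (at_left 1)"
    by simp
  then show "ereal (pi / Delta A) \<le> lor_dist A aff_id z"
    by (rule tendsto_upperbound) (use ev ge in \<open>auto elim!: eventually_mono\<close>)
qed

text \<open>A null segment leads from \<open>(1, -1)\<close> down to \<open>(1, 1 - e)\<close>. If the target is \<open>(p, q)\<close>, then
  because of \<open>q > 1\<close> the line on which the null coordinates differ by \<open>e\<close> can be followed from there to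
  \<open>(q, q - e)\<close>, which gives the length \<open>2 (q - 1) / (e \<Delta>)\<close>, and two null segments complete the curve.\<close>

lemma lor_dist_E:
  assumes "z \<in> Aff" "1 < null_q A z"
  shows "lor_dist A aff_id z = \<infinity>"
proof (rule ereal_top)
  fix B :: real
  define p q where "p = null_p A z" and "q = null_q A z"
  have pq: "1 < q" "q < p" using assms by (auto simp: p_def q_def Aff_iff)
  define M where "M = max 1 B"
  have M: "1 \<le> M" "B \<le> M" by (auto simp: M_def)
  \<comment> \<open>The bound \<open>2\<close> makes the first segment one of increasing \<open>q\<close>, the other bound makes the length
  at least \<open>M\<close>.\<close>
  define e where "e = min 2 (2 * (q - 1) / (Delta A * M))"
  have e: "0 < e" "e \<le> 2" using pq Delta_pos M by (auto simp: e_def)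
  have "e \<le> 2 * (q - 1) / (Delta A * M)" by (simp add: e_def)
  then have "M \<le> 2 * (q - 1) / e / Delta A"
    using e Delta_pos M by (simp add: pos_le_divide_eq mult_ac)
  then have B: "ereal B \<le> ereal (2 * (q - 1) / e / Delta A)" using M(2) by simp
  have "realizes A (null_point 1 (-1)) (null_point 1 (1 - e)) 0"
    using e by (intro realizes_null_q) auto
  moreover have "realizes A (null_point 1 (1 - e)) (null_point q (q - e)) (2 * (q - 1) / e / Delta A)"
    using realizes_near_boundary[of e "q - 1" 1] e pq by simp
  moreover have "realizes A (null_point q (q - e)) (null_point p (q - e)) 0"
    using e pq by (intro realizes_null_p) auto
  moreover have "realizes A (null_point p (q - e)) (null_point p q) 0"
    using e pq by (intro realizes_null_q) auto
  ultimately have "realizes A (null_point 1 (-1)) (null_point p q) (0 + 2 * (q - 1) / e / Delta A + 0 + 0)"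
    by (intro realizes_trans)
  then have "realizes A aff_id z (2 * (q - 1) / e / Delta A)"
    by (simp add: null_point_start p_def q_def)
  then show "ereal B \<le> lor_dist A aff_id z" using B lor_dist_ge order_trans by blast
qed

lemma continuous_null: "continuous_on UNIV (null_p A)" "continuous_on UNIV (null_q A)"
  unfolding null_p_def[abs_def] null_q_def[abs_def] lambda1_def lambda2_def
  using det_pos by (auto intro!: continuous_intros)

text \<open>A point of \<open>D\<close> with \<open>p = 1\<close> or \<open>q = -1\<close> is not interior, because an arbitrarily small decrease of that
  coordinate alone leaves \<open>D\<close>.\<close>

lemma interior_region_D:
  "top_of_set Aff interior_of region_D A = {z. 1 < null_p A z \<and> -1 < null_q A z \<and> null_q A z < 1}"
    (is "?I = ?R")
proof
  have R: "?R \<subseteq> region_D A"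
    by (auto simp: region_D_def Aff_iff lambda1_le_iff lambda2_ge_iff lambda3_pos_iff)
  have "open ?R"
    using continuous_null by (intro open_Collect_conj open_Collect_less continuous_intros)
  then have "openin (top_of_set Aff) ?R"
    using R by (intro open_subset) (auto simp: region_D_def)
  then show "?R \<subseteq> ?I" using R by (intro interior_of_maximal)
next
  show "?I \<subseteq> ?R"
  proof
    fix z assume z: "z \<in> ?I"
    then have "z \<in> region_D A" by (rule subsetD[OF interior_of_subset])
    then have q1: "null_q A z < 1" by (simp add: region_D_def lambda3_pos_iff)
    obtain U where U: "openin (top_of_set Aff) U" "z \<in> U" "U \<subseteq> region_D A"
      using z unfolding interior_of_def by auto
    have "open Aff" unfolding Aff_def by (intro open_Collect_less continuous_intros)
    then have "open U" using U(1) by (simp add: openin_open_eq)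
    have near: "\<exists>s>0. f s \<in> U" if f: "isCont f 0" "f 0 = z" for f :: "real \<Rightarrow> real \<times> real"
    proof -
      have "(f \<longlongrightarrow> z) (at 0)" using f by (simp add: isCont_def)
      then have "(f \<longlongrightarrow> z) (at_right 0)" by (rule tendsto_mono[OF at_le, rotated]) simp
      then have "\<forall>\<^sub>F s in at_right 0. f s \<in> U" using \<open>open U\<close> U(2) by (rule topological_tendstoD)
      then have "\<forall>\<^sub>F s in at_right 0. f s \<in> U \<and> 0 < s"
        using eventually_at_right_less by (rule eventually_conj)
      then show ?thesis using eventually_happens by fastforce
    qed
    have "isCont (\<lambda>s. null_point (null_p A z - s) (null_q A z)) 0"
      unfolding null_point_def by (auto intro!: continuous_intros)
    from near[OF this] obtain s where "s > 0" "null_point (null_p A z - s) (null_q A z) \<in> region_D A"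
      using U(3) by auto
    then have "1 < null_p A z" by (simp add: region_D_def lambda2_ge_iff)
    have "isCont (\<lambda>s. null_point (null_p A z) (null_q A z - s)) 0"
      unfolding null_point_def by (auto intro!: continuous_intros)
    from near[OF this] obtain s where "s > 0" "null_point (null_p A z) (null_q A z - s) \<in> region_D A"
      using U(3) by auto
    then have "-1 < null_q A z" by (simp add: region_D_def lambda1_le_iff)
    then show "z \<in> ?R" using q1 \<open>1 < null_p A z\<close> by simp
  qed
qed

lemma frontier_J_plus:
  assumes "z \<in> top_of_set Aff frontier_of J_plus A" "z \<in> J_plus A"
  shows "null_p A z = 1 \<or> null_q A z = -1"
proof (rule ccontr)
  let ?R = "{z. null_q A z < null_p A z \<and> 1 < null_p A z \<and> -1 < null_q A z}"
  assume "\<not> ?thesis"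
  then have z: "z \<in> ?R" using assms(2) by (auto simp: J_plus_iff Aff_iff)
  have R: "?R \<subseteq> J_plus A" by (auto simp: J_plus_iff Aff_iff)
  have "open ?R"
    using continuous_null by (intro open_Collect_conj open_Collect_less continuous_intros)
  then have "openin (top_of_set Aff) ?R"
    by (intro open_subset) (auto simp: Aff_iff)
  then have "?R \<subseteq> top_of_set Aff interior_of J_plus A" using R by (intro interior_of_maximal)
  then show False using z assms(1) by (auto simp: frontier_of_def)
qed

lemma arcsin_formula:
  assumes "1 < null_p A (x, y)" "-1 < null_q A (x, y)" "null_q A (x, y) < 1"
  shows "let w = (x - nu A * (y - 1)) / lam A;
             \<tau> = arcsin ((y\<^sup>2 + w\<^sup>2 - 1) / (2 * y * w));
             \<rho> = arcsin ((y\<^sup>2 - w\<^sup>2 - 1) / (2 * w))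
         in \<tau> - \<rho> = null_dist (null_p A (x, y)) (null_q A (x, y))"
proof -
  define w where "w = (x - nu A * (y - 1)) / lam A"
  have w: "w = (null_p A (x, y) + null_q A (x, y)) / 2"
    using time_eq_null_mean[of "(x, y)"] by (simp add: w_def)
  have y: "y = (null_p A (x, y) - null_q A (x, y)) / 2"
    using null_p_minus_q[of "(x, y)"] by simp
  have "w + y = null_p A (x, y)" "w - y = null_q A (x, y)" using w y by argo+
  moreover from this have "0 < y" "\<bar>y - 1\<bar> < w" "w < y + 1" using assms by linarith+
  ultimately show ?thesis
    using arcsin_difference_eq_null_dist[of y w] by (simp add: Let_def w_def)
qed

text \<open>All values are attained on the line \<open>p = 2\<close>: there the equation \<open>(1 - p q) / (p - q) = k\<close> has the
  solution \<open>q = (1 - 2 k) / (2 - k)\<close>, and \<open>-1 < q < 1\<close> is equivalent to \<open>-1 < k < 1\<close>.\<close>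

lemma lor_dist_image:
  "lor_dist A aff_id ` (top_of_set Aff interior_of region_D A) = {0<..<ereal (pi / Delta A)}"
  unfolding interior_region_D
proof (intro equalityI subsetI)
  fix e assume "e \<in> lor_dist A aff_id ` {z. 1 < null_p A z \<and> -1 < null_q A z \<and> null_q A z < 1}"
  then obtain z where z: "1 < null_p A z" "-1 < null_q A z" "null_q A z < 1"
    and e: "e = lor_dist A aff_id z" by auto
  show "e \<in> {0<..<ereal (pi / Delta A)}"
    unfolding e lor_dist_geodesic[OF z]
    using strict_null_dist_bounds[OF z] Delta_pos by (simp add: divide_strict_right_mono)
next
  fix e assume "e \<in> {0<..<ereal (pi / Delta A)}"
  then obtain s where s: "e = ereal s" "0 < s" "s < pi / Delta A"
    by (cases e) auto
  define k where "k = cos (s * Delta A)"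
  have sD: "0 < s * Delta A" "s * Delta A < pi"
    using s Delta_pos by (auto simp: pos_less_divide_eq)
  have k: "-1 < k" "k < 1"
    using cos_monotone_0_pi[of 0 "s * Delta A"] cos_monotone_0_pi[of "s * Delta A" pi] sD
    by (auto simp: k_def)
  define q where "q = (1 - 2 * k) / (2 - k)"
  have q: "-1 < q" "q < 1" using k by (auto simp: q_def field_simps)
  have "2 - q = 3 / (2 - k)" "1 - 2 * q = 3 * k / (2 - k)"
    using k by (simp_all add: q_def field_simps)
  then have "(1 - 2 * q) / (2 - q) = k" using k by simp
  then have "null_dist 2 q = s * Delta A"
    using sD by (simp add: null_dist_def k_def arccos_cos)
  then have "lor_dist A aff_id (null_point 2 q) = e"
    using lor_dist_geodesic[of "null_point 2 q"] q Delta_pos s by simp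
  moreover have "null_point 2 q \<in> {z. 1 < null_p A z \<and> -1 < null_q A z \<and> null_q A z < 1}"
    using q by simp
  ultimately show "e \<in> lor_dist A aff_id ` {z. 1 < null_p A z \<and> -1 < null_q A z \<and> null_q A z < 1}"
    by force
qed

end

theorem theorem14:
  fixes A :: "real^2^2" and x1 y1 :: real
  assumes "det A > 0" and "A$1$1 \<ge> 0" and "sectional_curvature A < 0"
    and "(x1, y1) \<in> Aff"
  shows
    "((x1, y1) \<notin> J_plus A \<longrightarrow> lor_dist A aff_id (x1, y1) = 0) \<and>
     ((x1, y1) \<in> top_of_set Aff frontier_of J_plus A \<longrightarrow> lor_dist A aff_id (x1, y1) = 0) \<and>
     ((x1, y1) \<in> top_of_set Aff interior_of region_D A \<longrightarrow>
        (let w = (x1 - nu A * (y1 - 1)) / lam A;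
             \<tau> = arcsin ((y1\<^sup>2 + w\<^sup>2 - 1) / (2 * y1 * w));
             \<rho> = arcsin ((y1\<^sup>2 - w\<^sup>2 - 1) / (2 * w))
         in lor_dist A aff_id (x1, y1) = ereal ((\<tau> - \<rho>) / Delta A))) \<and>
     lor_dist A aff_id ` (top_of_set Aff interior_of region_D A) = {0<..<ereal (pi / Delta A)} \<and>
     ((x1, y1) \<in> region_F A \<longrightarrow> lor_dist A aff_id (x1, y1) = ereal (pi / Delta A)) \<and>
     ((x1, y1) \<in> region_E A \<longrightarrow> lor_dist A aff_id (x1, y1) = \<infinity>)"
proof -
  have "(A$2$1)\<^sup>2 < (A$1$1)\<^sup>2"
    using assms(1,3) by (simp add: sectional_curvature_eq divide_less_0_iff)
  then have "\<bar>A$2$1\<bar> < A$1$1"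
    using power2_less_imp_less[of "\<bar>A$2$1\<bar>" "A$1$1"] assms(2) by simp
  then interpret negatively_curved A
    using assms(1) by (intro negatively_curved.intro)
  show ?thesis
  proof (intro conjI impI)
    assume "(x1, y1) \<in> top_of_set Aff frontier_of J_plus A"
    then show "lor_dist A aff_id (x1, y1) = 0"
      using lor_dist_outside frontier_J_plus lor_dist_light_cone by blast
  next
    assume "(x1, y1) \<in> top_of_set Aff interior_of region_D A"
    then have "1 < null_p A (x1, y1)" "-1 < null_q A (x1, y1)" "null_q A (x1, y1) < 1"
      by (simp_all add: interior_region_D)
    then show "let w = (x1 - nu A * (y1 - 1)) / lam A;
             \<tau> = arcsin ((y1\<^sup>2 + w\<^sup>2 - 1) / (2 * y1 * w));
             \<rho> = arcsin ((y1\<^sup>2 - w\<^sup>2 - 1) / (2 * w))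
         in lor_dist A aff_id (x1, y1) = ereal ((\<tau> - \<rho>) / Delta A)"
      using arcsin_formula[of x1 y1] lor_dist_geodesic[of "(x1, y1)"] by (simp add: Let_def)
  next
    assume "(x1, y1) \<in> region_F A"
    then show "lor_dist A aff_id (x1, y1) = ereal (pi / Delta A)"
      using lor_dist_F[of "(x1, y1)"] by (simp add: region_F_def lambda3_eq_iff)
  next
    assume "(x1, y1) \<in> region_E A"
    then show "lor_dist A aff_id (x1, y1) = \<infinity>"
      using lor_dist_E[of "(x1, y1)"] by (simp add: region_E_def lambda3_neg_iff)
  qed (use lor_dist_outside lor_dist_image in auto)
qed

end
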